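(* There exists a smooth embedding $F_0:M\to\mathbb{R}^4$ of a two-torus $M$ whose normal bundle is flat, such that along the mean curvature flow $F:M\times[0,T)\to\mathbb{R}^4$ starting from $F_0$ there is $\delta\in(0,T)$ with the property that for every $t\in(0,\delta)$ the normal bundle of $F_t=F(\cdot,t)$ is not flat.
   Context: For an immersion $F:M^m\to\mathbb{R}^n$, the normal connection is $\nabla^\perp_X\nu=(D_X\nu)^\perp$, where $D$ is the Euclidean connection and $(\cdot)^\perp$ is the projection to the normal bundle $T^\perp M$. Its curvature is $R^\perp(X,Y)\nu=\nabla^\perp_X\nabla^\perp_Y\nu-\nabla^\perp_Y\nabla^\perp_X\nu-\nabla^\perp_{[X,Y]}\nu$. The immersion has flat normal bundle if $R^\perp\equiv0$. The second fundamental form is $A(X,Y)=(D_XY)^\perp$ and the mean curvature vector is $H=\mathrm{tr}_g A$, where $g$ is the induced metric. A mean curvature flow starting from $F_0$ is a smooth family of immersions $F:M\times[0,T)\to\mathbb{R}^n$, $T>0$, with $\frac{dF}{dt}(\cdot,t)=H(\cdot,t)$ and $F(\cdot,0)=F_0$; here $H(\cdot,t)$ is the mean curvature vector of $F(\cdot,t)$. For compact $M$ without boundary, a unique such smooth solution exists on a short time interval. *)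

theory Defs
  imports "HOL-Analysis.Analysis"
begin

primrec Ck_on :: "nat \<Rightarrow> 'a::euclidean_space set \<Rightarrow> ('a \<Rightarrow> 'b::euclidean_space) \<Rightarrow> bool" where
  "Ck_on 0 U f \<longleftrightarrow> continuous_on U f"
| "Ck_on (Suc k) U f \<longleftrightarrow> (\<forall>x\<in>U. f differentiable (at x)) \<and>
     (\<forall>v. Ck_on k U (\<lambda>x. frechet_derivative f (at x) v))"

text \<open>Smoothness on an arbitrary set means that a smooth extension to an open neighbourhood exists
  locally. On \<open>UNIV \<times> {0..<T}\<close> this is smoothness up to and including time \<open>0\<close>.\<close>

definition smooth_on :: "'a::euclidean_space set \<Rightarrow> ('a \<Rightarrow> 'b::euclidean_space) \<Rightarrow> bool" where
  "smooth_on S f \<longleftrightarrow>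
     (\<forall>x\<in>S. \<exists>U g. open U \<and> x \<in> U \<and> (\<forall>k. Ck_on k U g) \<and> (\<forall>y\<in>S \<inter> U. g y = f y))"


section \<open>Immersions in coordinates\<close>

text \<open>A vector field \<open>X\<close> on the domain is given by its components in the coordinate frame, so the
  Euclidean derivative of a vector-valued function \<open>\<nu>\<close> along \<open>f\<close> in direction \<open>X\<close> is \<open>deriv_along X \<nu>\<close>.\<close>

definition deriv_along ::
  "(real^'m \<Rightarrow> real^'m) \<Rightarrow> (real^'m \<Rightarrow> 'b::euclidean_space) \<Rightarrow> real^'m \<Rightarrow> 'b" where
  "deriv_along X h x = frechet_derivative h (at x) (X x)"

definition lie_bracket ::
  "(real^'m \<Rightarrow> real^'m) \<Rightarrow> (real^'m \<Rightarrow> real^'m) \<Rightarrow> real^'m \<Rightarrow> real^'m" where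
  "lie_bracket X Y x = deriv_along X Y x - deriv_along Y X x"

definition tangent_space_at :: "(real^'m \<Rightarrow> real^'n) \<Rightarrow> real^'m \<Rightarrow> (real^'n) set" where
  "tangent_space_at f x = range (frechet_derivative f (at x))"

definition normal_space_at :: "(real^'m \<Rightarrow> real^'n) \<Rightarrow> real^'m \<Rightarrow> (real^'n) set" where
  "normal_space_at f x = orthogonal_comp (tangent_space_at f x)"

definition normal_proj :: "(real^'m \<Rightarrow> real^'n) \<Rightarrow> real^'m \<Rightarrow> real^'n \<Rightarrow> real^'n" where
  "normal_proj f x v = (THE w. w \<in> normal_space_at f x \<and> v - w \<in> tangent_space_at f x)"

definition normal_conn ::
  "(real^'m \<Rightarrow> real^'n) \<Rightarrow> (real^'m \<Rightarrow> real^'m) \<Rightarrow> (real^'m \<Rightarrow> real^'n) \<Rightarrow> real^'m \<Rightarrow> real^'n" where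
  "normal_conn f X \<nu> x = normal_proj f x (deriv_along X \<nu> x)"

definition normal_curvature ::
  "(real^'m \<Rightarrow> real^'n) \<Rightarrow> (real^'m \<Rightarrow> real^'m) \<Rightarrow> (real^'m \<Rightarrow> real^'m) \<Rightarrow>
   (real^'m \<Rightarrow> real^'n) \<Rightarrow> real^'m \<Rightarrow> real^'n" where
  "normal_curvature f X Y \<nu> x =
     normal_conn f X (normal_conn f Y \<nu>) x
   - normal_conn f Y (normal_conn f X \<nu>) x
   - normal_conn f (lie_bracket X Y) \<nu> x"

text \<open>In \<open>(D\<^sub>X Y)\<^sup>\<bottom>\<close> the tangent field \<open>Y\<close> is differentiated as the \<open>real^'n\<close>-valued function
  \<open>df(Y)\<close>.\<close>

definition second_ff ::
  "(real^'m \<Rightarrow> real^'n) \<Rightarrow> (real^'m \<Rightarrow> real^'m) \<Rightarrow> (real^'m \<Rightarrow> real^'m) \<Rightarrow> real^'m \<Rightarrow> real^'n" where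
  "second_ff f X Y x = normal_proj f x (deriv_along X (deriv_along Y f) x)"

definition coord_field :: "'m \<Rightarrow> real^'m \<Rightarrow> real^'m" where
  "coord_field i x = axis i 1"

definition induced_metric :: "(real^'m \<Rightarrow> real^'n) \<Rightarrow> real^'m \<Rightarrow> real^'m^'m" where
  "induced_metric f x =
     (\<chi> i j. deriv_along (coord_field i) f x \<bullet> deriv_along (coord_field j) f x)"

definition mean_curvature :: "(real^'m \<Rightarrow> real^'n) \<Rightarrow> real^'m \<Rightarrow> real^'n" where
  "mean_curvature f x =
     (\<Sum>i\<in>UNIV. \<Sum>j\<in>UNIV. matrix_inv (induced_metric f x) $ i $ j *\<^sub>R
        second_ff f (coord_field i) (coord_field j) x)"


section \<open>The two-torus\<close>

text \<open>The two-torus is \<open>S\<^sup>1 \<times> S\<^sup>1\<close>, with the smooth structure whose charts are the local inverses of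
  the covering \<open>torus_cover\<close>. The coordinate fields of these charts agree on overlaps and form a global
  frame, so vector fields on the torus are the same as functions \<open>torus \<Rightarrow> real^2\<close>. All local objects
  are computed after composition with the covering.\<close>

definition torus :: "(complex \<times> complex) set" where
  "torus = sphere 0 1 \<times> sphere 0 1"

definition torus_cover :: "real^2 \<Rightarrow> complex \<times> complex" where
  "torus_cover x = (cis (2 * pi * x $ 1), cis (2 * pi * x $ 2))"

definition torus_smooth :: "(complex \<times> complex \<Rightarrow> 'b::euclidean_space) \<Rightarrow> bool" where
  "torus_smooth h \<longleftrightarrow> smooth_on UNIV (h \<circ> torus_cover)"

definition torus_immersion :: "(complex \<times> complex \<Rightarrow> real^'n) \<Rightarrow> bool" where
  "torus_immersion F \<longleftrightarrow> torus_smooth F \<and>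
     (\<forall>x. inj (frechet_derivative (F \<circ> torus_cover) (at x)))"

definition torus_embedding :: "(complex \<times> complex \<Rightarrow> real^'n) \<Rightarrow> bool" where
  "torus_embedding F \<longleftrightarrow> torus_immersion F \<and> embedding_map (top_of_set torus) euclidean F"

definition torus_normal_field ::
  "(complex \<times> complex \<Rightarrow> real^'n) \<Rightarrow> (complex \<times> complex \<Rightarrow> real^'n) \<Rightarrow> bool" where
  "torus_normal_field F \<nu> \<longleftrightarrow> torus_smooth \<nu> \<and>
     (\<forall>x. \<nu> (torus_cover x) \<in> normal_space_at (F \<circ> torus_cover) x)"

definition flat_normal_bundle :: "(complex \<times> complex \<Rightarrow> real^'n) \<Rightarrow> bool" where
  "flat_normal_bundle F \<longleftrightarrow>
     (\<forall>(X :: complex \<times> complex \<Rightarrow> real^2) (Y :: complex \<times> complex \<Rightarrow> real^2) \<nu>.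
        torus_smooth X \<longrightarrow> torus_smooth Y \<longrightarrow> torus_normal_field F \<nu> \<longrightarrow>
        (\<forall>x. normal_curvature (F \<circ> torus_cover) (X \<circ> torus_cover) (Y \<circ> torus_cover)
               (\<nu> \<circ> torus_cover) x = 0))"

text \<open>Only the restriction of \<open>F t\<close> to \<open>torus\<close> and \<open>t \<in> {0..<T}\<close> matters; at \<open>t = 0\<close> the time
  derivative is one-sided.\<close>

definition torus_mcf ::
  "(complex \<times> complex \<Rightarrow> real^'n) \<Rightarrow> real \<Rightarrow> (real \<Rightarrow> complex \<times> complex \<Rightarrow> real^'n) \<Rightarrow> bool" where
  "torus_mcf F0 T F \<longleftrightarrow> 0 < T \<and>
     smooth_on (UNIV \<times> {0..<T}) (\<lambda>(x, t). F t (torus_cover x)) \<and>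
     (\<forall>t\<in>{0..<T}. torus_immersion (F t)) \<and>
     (\<forall>t\<in>{0..<T}. \<forall>x. ((\<lambda>s. F s (torus_cover x)) has_vector_derivative
        mean_curvature (F t \<circ> torus_cover) x) (at t within {0..<T})) \<and>
     (\<forall>p\<in>torus. F 0 p = F0 p)"

end

theory Submission
  imports Defs
begin

text \<open>
  Let \<open>\<gamma>\<close> be a closed convex plane curve with unit normal \<open>n\<close> and let \<open>(x, y, z)\<close> be a closed curve.
  The second derivative of \<open>(s, \<theta>) \<mapsto> (\<gamma>(s) + x(\<theta>) n(s), y(\<theta>), z(\<theta>))\<close> in the directions
  \<open>s, \<theta>\<close> is tangent and these directions are orthogonal, so all shape operators commute and the
  normal bundle is flat. Flatness means that the commutator \<open>B\<close> of the shape operators vanishes, and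
  \<open>B\<close> is a polynomial in the first two derivatives of the immersion. Along the flow, \<open>B'(0)\<close> is
  obtained by replacing each derivative of the immersion in turn by the same derivative of the mean
  curvature vector \<open>H\<close>. For non-circular \<open>\<gamma>\<close> and \<open>(x, y, z) = (3 sin \<theta>, 4 sin \<theta>, 5 cos \<theta>)\<close> it is
  not identically zero, because the mixed component of the normal Hessian of \<open>H\<close> is not everywhere
  a multiple of the difference of the two principal normal curvature vectors.
\<close>

section \<open>Continuously differentiable functions\<close>

lemma Ck_on_cong:
  assumes "open U" "\<And>x. x \<in> U \<Longrightarrow> f x = g x"
  shows "Ck_on k U f \<longleftrightarrow> Ck_on k U g"
  using assms(2)
proof (induction k arbitrary: f g)
  case 0
  then show ?case by (auto cong: continuous_on_cong)
next
  case (Suc k)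
  have diff: "f differentiable (at x) \<longleftrightarrow> g differentiable (at x)" if "x \<in> U" for x
    using that Suc.prems assms(1) unfolding differentiable_def
    by (metis has_derivative_transform_within_open)
  have "frechet_derivative f (at x) = frechet_derivative g (at x)"
    if "x \<in> U" "\<forall>x\<in>U. f differentiable (at x)" for x
    using frechet_derivative_transform_within_open[of f x U g] that Suc.prems assms(1) by auto
  then have "Ck_on k U (\<lambda>x. frechet_derivative f (at x) v)
      \<longleftrightarrow> Ck_on k U (\<lambda>x. frechet_derivative g (at x) v)"
    if "\<forall>x\<in>U. f differentiable (at x)" for v
    using that by (intro Suc.IH) auto
  with diff show ?case by auto
qed

lemma Ck_on_local:
  assumes "\<And>x. x \<in> S \<Longrightarrow> \<exists>U. open U \<and> x \<in> U \<and> Ck_on k U f"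
  shows "Ck_on k S f"
  using assms
proof (induction k arbitrary: f)
  case 0
  then have "continuous (at x) f" if "x \<in> S" for x
    using that continuous_on_eq_continuous_at by fastforce
  then show ?case
    by (simp add: continuous_at_imp_continuous_on)
next
  case (Suc k)
  have "Ck_on k S (\<lambda>x. frechet_derivative f (at x) v)" for v
    using Suc.prems by (intro Suc.IH) fastforce
  moreover have "f differentiable (at x)" if "x \<in> S" for x
    using Suc.prems[OF that] by auto
  ultimately show ?case by auto
qed

lemma smooth_on_UNIV: "smooth_on UNIV f \<longleftrightarrow> (\<forall>k. Ck_on k UNIV f)"
proof
  assume s: "smooth_on UNIV f"
  show "\<forall>k. Ck_on k UNIV f"
  proof (intro allI Ck_on_local)
    fix k and x :: 'a
    obtain U g where "open U" "x \<in> U" "Ck_on k U g" "\<forall>y\<in>U. g y = f y"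
      using s unfolding smooth_on_def by (metis Int_iff UNIV_I)
    then show "\<exists>U. open U \<and> x \<in> U \<and> Ck_on k U f"
      using Ck_on_cong[of U g f k] by auto
  qed
next
  assume "\<forall>k. Ck_on k UNIV f"
  then show "smooth_on UNIV f"
    unfolding smooth_on_def by (metis open_UNIV UNIV_I)
qed

lemma Ck_on_SucD: "Ck_on (Suc k) U f \<Longrightarrow> Ck_on k U f"
proof (induction k arbitrary: f)
  case 0
  then show ?case
    by (auto intro!: continuous_at_imp_continuous_on differentiable_imp_continuous_within)
qed auto

lemma Ck_on_const: "Ck_on k U (\<lambda>x. c)"
  by (induction k arbitrary: c) auto

lemma Ck_on_SucI:
  assumes "open U" "\<And>x. x \<in> U \<Longrightarrow> (f has_derivative f' x) (at x)" "\<And>v. Ck_on k U (\<lambda>x. f' x v)"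
  shows "Ck_on (Suc k) U f"
proof -
  have "Ck_on k U (\<lambda>x. frechet_derivative f (at x) v)" for v
    by (rule Ck_on_cong[OF assms(1), THEN iffD1, OF _ assms(3)])
      (simp add: frechet_derivative_at[OF assms(2)])
  then show ?thesis
    using differentiableI[OF assms(2)] by auto
qed

lemma Ck_on_has_derivative:
  assumes "Ck_on (Suc k) U f" "x \<in> U"
  shows "(f has_derivative frechet_derivative f (at x)) (at x)"
  using assms by (auto simp: frechet_derivative_works)

lemma Ck_on_bounded_linear:
  assumes "bounded_linear L" "open U" "Ck_on k U f"
  shows "Ck_on k U (\<lambda>x. L (f x))"
  using assms(3)
proof (induction k arbitrary: f)
  case 0
  then show ?case
    using assms(1) bounded_linear.continuous_on by auto
next
  case (Suc k)
  show ?case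
    by (rule Ck_on_SucI[OF assms(2)
          bounded_linear.has_derivative[OF assms(1) Ck_on_has_derivative[OF Suc.prems]]])
      (use Suc in auto)
qed

lemma Ck_on_add:
  assumes "open U" "Ck_on k U f" "Ck_on k U g"
  shows "Ck_on k U (\<lambda>x. f x + g x)"
  using assms(2,3)
proof (induction k arbitrary: f g)
  case 0
  then show ?case by (auto intro: continuous_on_add)
next
  case (Suc k)
  show ?case
    by (rule Ck_on_SucI[OF assms(1) has_derivative_add[OF
            Ck_on_has_derivative[OF Suc.prems(1)] Ck_on_has_derivative[OF Suc.prems(2)]]])
      (use Suc in auto)
qed

lemma Ck_on_bilinear:
  fixes p :: "'b::euclidean_space \<Rightarrow> 'c::euclidean_space \<Rightarrow> 'd::euclidean_space"
  assumes "bounded_bilinear p" "open U" "Ck_on k U f" "Ck_on k U g"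
  shows "Ck_on k U (\<lambda>x. p (f x) (g x))"
  using assms(3,4)
proof (induction k arbitrary: f g)
  case 0
  then show ?case by (auto intro: bounded_bilinear.continuous_on[OF assms(1)])
next
  case (Suc k)
  show ?case
    by (rule Ck_on_SucI[OF assms(2) bounded_bilinear.FDERIV[OF assms(1)
            Ck_on_has_derivative[OF Suc.prems(1)] Ck_on_has_derivative[OF Suc.prems(2)]]])
      (use Suc.prems Ck_on_SucD[OF Suc.prems(1)] Ck_on_SucD[OF Suc.prems(2)]
        in \<open>auto intro!: Ck_on_add assms(2) Suc.IH\<close>)
qed

lemma Ck_on_sin_cos:
  fixes L :: "'a::euclidean_space \<Rightarrow> real"
  assumes L: "bounded_linear L"
  shows "Ck_on k UNIV (\<lambda>x. sin (L x)) \<and> Ck_on k UNIV (\<lambda>x. cos (L x))"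
proof (induction k)
  case 0
  have "continuous_on UNIV L"
    using L linear_continuous_on by blast
  then show ?case by (auto intro!: continuous_intros)
next
  case (Suc k)
  have d: "((\<lambda>x. sin (L x)) has_derivative (\<lambda>v. L v *\<^sub>R cos (L x))) (at x)"
     "((\<lambda>x. cos (L x)) has_derivative (\<lambda>v. (- L v) *\<^sub>R sin (L x))) (at x)" for x
    by (rule derivative_eq_intros bounded_linear_imp_has_derivative[OF L] refl | simp)+
  show ?case
    using Suc
    by (auto intro!: Ck_on_SucI[OF _ d(1)] Ck_on_SucI[OF _ d(2)]
        Ck_on_bounded_linear[OF bounded_linear_scaleR_right] simp del: Ck_on.simps)
qed

lemma mixed_difference:
  fixes f :: "'a::euclidean_space \<Rightarrow> real"
  assumes U: "ball x e \<subseteq> U" and f: "Ck_on 2 U f" and h: "0 < h" "h * (norm v + norm w) < e"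
  shows "\<exists>y\<in>U. dist y x \<le> h * (norm v + norm w) \<and>
     f (x + h *\<^sub>R v + h *\<^sub>R w) - f (x + h *\<^sub>R v) - f (x + h *\<^sub>R w) + f x
       = h\<^sup>2 * frechet_derivative (\<lambda>z. frechet_derivative f (at z) v) (at y) w"
proof -
  define p where "p a b = x + a *\<^sub>R v + b *\<^sub>R w" for a b
  have np: "dist (p a b) x \<le> h * (norm v + norm w)" if "a \<in> {0..h}" "b \<in> {0..h}" for a b
  proof -
    have "dist (p a b) x = norm (a *\<^sub>R v + b *\<^sub>R w)"
      by (simp add: p_def dist_norm)
    also have "\<dots> \<le> a * norm v + b * norm w"
      using that norm_triangle_ineq[of "a *\<^sub>R v" "b *\<^sub>R w"] by simp
    also have "\<dots> \<le> h * norm v + h * norm w"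
      using that by (intro add_mono mult_right_mono) auto
    finally show ?thesis by (simp add: algebra_simps)
  qed
  have pU: "p a b \<in> U" if "a \<in> {0..h}" "b \<in> {0..h}" for a b
  proof -
    have "p a b \<in> ball x e" using np[OF that] h by (simp add: dist_commute)
    then show ?thesis using U by blast
  qed
  have d1: "(f has_derivative frechet_derivative f (at y)) (at y)" if "y \<in> U" for y
    using f that by (auto simp: numeral_2_eq_2 frechet_derivative_works)
  have d2: "((\<lambda>z. frechet_derivative f (at z) v) has_derivative
      frechet_derivative (\<lambda>z. frechet_derivative f (at z) v) (at y)) (at y)" if "y \<in> U" for y
    using f that by (auto simp: numeral_2_eq_2 frechet_derivative_works)
  have D1: "((\<lambda>a. f (p a b)) has_real_derivative frechet_derivative f (at (p a b)) v) (at a)"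
    if "a \<in> {0..h}" "b \<in> {0..h}" for a b
  proof -
    have "((\<lambda>a. p a b) has_derivative (\<lambda>t. t *\<^sub>R v)) (at a)"
      unfolding p_def by (auto intro!: derivative_eq_intros)
    from has_derivative_compose[OF this d1[OF pU[OF that]]]
    show ?thesis
      by (simp add: has_field_derivative_def linear_cmul[OF has_derivative_linear[OF d1[OF pU[OF that]]]]
           mult.commute[of _ "frechet_derivative f _ _"])
  qed
  have D2: "((\<lambda>b. frechet_derivative f (at (p a b)) v) has_real_derivative
       frechet_derivative (\<lambda>z. frechet_derivative f (at z) v) (at (p a b)) w) (at b)"
    if "a \<in> {0..h}" "b \<in> {0..h}" for a b
  proof -
    have "((\<lambda>b. p a b) has_derivative (\<lambda>t. t *\<^sub>R w)) (at b)"
      unfolding p_def by (auto intro!: derivative_eq_intros)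
    from has_derivative_compose[OF this d2[OF pU[OF that]]]
    show ?thesis
      by (simp add: has_field_derivative_def linear_cmul[OF has_derivative_linear[OF d2[OF pU[OF that]]]]
           mult.commute[of _ "frechet_derivative _ _ _"])
  qed
  have "\<exists>z. 0 < z \<and> z < h \<and> (f (p h h) - f (p h 0)) - (f (p 0 h) - f (p 0 0))
     = (h - 0) * (frechet_derivative f (at (p z h)) v - frechet_derivative f (at (p z 0)) v)"
    using h by (intro MVT2[where f = "\<lambda>a. f (p a h) - f (p a 0)"]) (auto intro!: DERIV_diff D1)
  then obtain a where a: "0 < a" "a < h" "(f (p h h) - f (p h 0)) - (f (p 0 h) - f (p 0 0))
     = h * (frechet_derivative f (at (p a h)) v - frechet_derivative f (at (p a 0)) v)"
    by auto
  have "\<exists>z. 0 < z \<and> z < h \<and> frechet_derivative f (at (p a h)) v - frechet_derivative f (at (p a 0)) v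
     = (h - 0) * frechet_derivative (\<lambda>z. frechet_derivative f (at z) v) (at (p a z)) w"
    using h a by (intro MVT2[where f = "\<lambda>b. frechet_derivative f (at (p a b)) v"]) (auto intro!: D2)
  then obtain b where b: "0 < b" "b < h"
    "frechet_derivative f (at (p a h)) v - frechet_derivative f (at (p a 0)) v
     = h * frechet_derivative (\<lambda>z. frechet_derivative f (at z) v) (at (p a b)) w" by auto
  show ?thesis
    using a b np[of a b] pU[of a b]
    by (intro bexI[of _ "p a b"]) (auto simp: p_def power2_eq_square algebra_simps)
qed

lemma frechet_derivative_commute_real:
  fixes f :: "'a::euclidean_space \<Rightarrow> real"
  assumes "open U" "x \<in> U" and f: "Ck_on 2 U f"
  shows "frechet_derivative (\<lambda>z. frechet_derivative f (at z) v) (at x) w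
       = frechet_derivative (\<lambda>z. frechet_derivative f (at z) w) (at x) v"
proof -
  obtain e where e: "0 < e" "ball x e \<subseteq> U"
    using assms openE by blast
  define G where "G v w y = frechet_derivative (\<lambda>z. frechet_derivative f (at z) v) (at y) w" for v w y
  have cont: "isCont (G v w) x" for v w
    unfolding G_def using f assms by (auto simp: numeral_2_eq_2 continuous_on_eq_continuous_at)
  define h where "h n = e / (norm v + norm w + 1) / real (n + 2)" for n
  define K where "K = norm v + norm w + 1"
  have K: "K > 0" unfolding K_def by (smt (verit) norm_ge_zero)
  have h: "0 < h n" "h n * (norm v + norm w) < e" for n
  proof -
    show "0 < h n" using e K by (simp add: h_def K_def[symmetric])
    have "h n * (norm v + norm w) < h n * K"
      using \<open>0 < h n\<close> by (simp add: K_def)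
    also have "\<dots> = e / real (n + 2)"
      using K unfolding h_def K_def[symmetric] by simp
    also have "\<dots> \<le> e" using e by (simp add: field_simps)
    finally show "h n * (norm v + norm w) < e" .
  qed
  have h0: "(\<lambda>n. h n * (norm v + norm w)) \<longlonglongrightarrow> 0"
    unfolding h_def using LIMSEQ_ignore_initial_segment[OF LIMSEQ_inverse_real_of_nat, of 1]
    by (auto intro!: tendsto_mult_left_zero tendsto_mult_right_zero simp: divide_inverse add.commute)
  have "\<exists>y z. dist y x \<le> h n * (norm v + norm w) \<and> dist z x \<le> h n * (norm v + norm w)
     \<and> G v w y = G w v z" for n
  proof -
    note m = mixed_difference[OF e(2) f]
    obtain y z where yz: "dist y x \<le> h n * (norm v + norm w)" "dist z x \<le> h n * (norm v + norm w)"
      "(h n)\<^sup>2 * G v w y = (h n)\<^sup>2 * G w v z"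
      using m[OF h(1)[of n] h(2)] m[of "h n" w v] h[of n] unfolding G_def
      by (auto simp: algebra_simps)
    then show ?thesis
      using h(1)[of n] by (metis less_irrefl mult_cancel_left zero_less_power)
  qed
  then obtain y z where yz: "\<And>n. dist (y n) x \<le> h n * (norm v + norm w)"
    "\<And>n. dist (z n) x \<le> h n * (norm v + norm w)" "\<And>n. G v w (y n) = G w v (z n)"
    by metis
  have "y \<longlonglongrightarrow> x" "z \<longlonglongrightarrow> x"
    by (rule metric_tendsto_imp_tendsto[OF h0 eventuallyI],
        use order_trans[OF yz(1) abs_ge_self] order_trans[OF yz(2) abs_ge_self] in simp)+
  then have "(\<lambda>n. G v w (y n)) \<longlonglongrightarrow> G v w x" "(\<lambda>n. G w v (z n)) \<longlonglongrightarrow> G w v x"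
    using cont isCont_tendsto_compose by blast+
  then show ?thesis
    using yz(3) LIMSEQ_unique unfolding G_def by auto
qed

lemma frechet_derivative_commute:
  fixes f :: "'a::euclidean_space \<Rightarrow> 'b::euclidean_space"
  assumes U: "open U" and x: "x \<in> U" and f: "Ck_on 2 U f"
  shows "frechet_derivative (\<lambda>z. frechet_derivative f (at z) v) (at x) w
       = frechet_derivative (\<lambda>z. frechet_derivative f (at z) w) (at x) v"
proof (rule euclidean_eqI)
  fix b :: 'b
  assume "b \<in> Basis"
  have b: "frechet_derivative (\<lambda>y. g y \<bullet> b) (at y) v = frechet_derivative g (at y) v \<bullet> b"
    if "g differentiable (at y)" for g :: "'a \<Rightarrow> 'b" and y v
    using frechet_derivative_at[OF has_derivative_inner_left[OF frechet_derivative_works[THEN iffD1, OF that]], of b]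
    by metis
  have *: "frechet_derivative (\<lambda>z. frechet_derivative f (at z) v) (at x) w \<bullet> b
      = frechet_derivative (\<lambda>z. frechet_derivative (\<lambda>y. f y \<bullet> b) (at z) v) (at x) w" for v w
  proof -
    have d: "(\<lambda>z. frechet_derivative f (at z) v) differentiable (at x)" 
      using f x by (auto simp: numeral_2_eq_2)
    then have "(\<lambda>z. frechet_derivative f (at z) v \<bullet> b) differentiable (at x)"
      by (simp add: differentiable_inner)
    moreover have "frechet_derivative f (at z) v \<bullet> b = frechet_derivative (\<lambda>y. f y \<bullet> b) (at z) v"
      if "z \<in> U" for z
      using f that by (subst b) (auto simp: numeral_2_eq_2)
    ultimately have "frechet_derivative (\<lambda>z. frechet_derivative f (at z) v \<bullet> b) (at x)
      = frechet_derivative (\<lambda>z. frechet_derivative (\<lambda>y. f y \<bullet> b) (at z) v) (at x)"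
      using U x by (intro frechet_derivative_transform_within_open)
    with b[OF d] show ?thesis by metis
  qed
  have "Ck_on 2 U (\<lambda>y. f y \<bullet> b)"
    using Ck_on_bounded_linear[OF bounded_linear_inner_left U f] .
  from frechet_derivative_commute_real[OF U x this]
  show "frechet_derivative (\<lambda>z. frechet_derivative f (at z) v) (at x) w \<bullet> b
       = frechet_derivative (\<lambda>z. frechet_derivative f (at z) w) (at x) v \<bullet> b"
    unfolding * .
qed

section \<open>The Ricci equation for surfaces\<close>

definition pd :: "'m::finite \<Rightarrow> (real^'m \<Rightarrow> 'b::euclidean_space) \<Rightarrow> real^'m \<Rightarrow> 'b" where
  "pd i f x = frechet_derivative f (at x) (axis i 1)"

lemma deriv_along_coord_field [simp]: "deriv_along (coord_field i) f = pd i f"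
  by (auto simp: deriv_along_def coord_field_def pd_def)

lemma frechet_derivative_pd:
  fixes f :: "real^2 \<Rightarrow> 'b::euclidean_space"
  assumes "f differentiable (at x)"
  shows "frechet_derivative f (at x) v = v $ 1 *\<^sub>R pd 1 f x + v $ 2 *\<^sub>R pd 2 f x"
proof -
  have l: "linear (frechet_derivative f (at x))"
    using assms linear_frechet_derivative by blast
  have "v = v $ 1 *\<^sub>R axis 1 1 + v $ 2 *\<^sub>R axis 2 1"
    by (simp add: vec_eq_iff forall_2 axis_def)
  then have "frechet_derivative f (at x) v
      = frechet_derivative f (at x) (v $ 1 *\<^sub>R axis 1 1 + v $ 2 *\<^sub>R axis 2 1)" by simp
  then show ?thesis
    by (simp add: linear_add[OF l] linear_cmul[OF l] pd_def)
qed

lemma pd_eqI: "(f has_derivative f') (at x) \<Longrightarrow> pd i f x = f' (axis i 1)"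
  unfolding pd_def by (metis frechet_derivative_at)

lemma pd_pd_commute:
  assumes "Ck_on 2 UNIV f"
  shows "pd i (pd j f) x = pd j (pd i f) x"
  using frechet_derivative_commute[OF open_UNIV UNIV_I assms] by (simp add: pd_def[abs_def])

lemma Ck_on_pd: "Ck_on (Suc k) U f \<Longrightarrow> Ck_on k U (pd i f)"
  by (simp add: pd_def[abs_def])

lemma normal_space_at_iff:
  fixes f :: "real^2 \<Rightarrow> real^'n"
  assumes "f differentiable (at x)"
  shows "w \<in> normal_space_at f x \<longleftrightarrow> w \<bullet> pd 1 f x = 0 \<and> w \<bullet> pd 2 f x = 0"
proof
  assume "w \<in> normal_space_at f x"
  then show "w \<bullet> pd 1 f x = 0 \<and> w \<bullet> pd 2 f x = 0"
    by (auto simp: normal_space_at_def tangent_space_at_def orthogonal_comp_def orthogonal_def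
       pd_def inner_commute)
next
  assume "w \<bullet> pd 1 f x = 0 \<and> w \<bullet> pd 2 f x = 0"
  then show "w \<in> normal_space_at f x"
    by (auto simp: normal_space_at_def tangent_space_at_def orthogonal_comp_def orthogonal_def
        frechet_derivative_pd[OF assms] inner_simps inner_commute)
qed

lemma normal_proj_eqI:
  fixes f :: "real^2 \<Rightarrow> real^'n"
  assumes f: "f differentiable (at x)"
    and w: "w \<bullet> pd 1 f x = 0" "w \<bullet> pd 2 f x = 0"
    and v: "v = w + a *\<^sub>R pd 1 f x + b *\<^sub>R pd 2 f x"
  shows "normal_proj f x v = w"
  unfolding normal_proj_def
proof (rule the_equality)
  have "v - w = frechet_derivative f (at x) (vector [a, b])"
    by (simp add: frechet_derivative_pd[OF f] v)
  then show "w \<in> normal_space_at f x \<and> v - w \<in> tangent_space_at f x"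
    using w by (auto simp: normal_space_at_iff[OF f] tangent_space_at_def)
next
  fix w'
  assume w': "w' \<in> normal_space_at f x \<and> v - w' \<in> tangent_space_at f x"
  then obtain u where "v - w' = frechet_derivative f (at x) u"
    by (auto simp: tangent_space_at_def)
  then have "w' - w = (a - u $ 1) *\<^sub>R pd 1 f x + (b - u $ 2) *\<^sub>R pd 2 f x"
    unfolding v frechet_derivative_pd[OF f] by (simp add: algebra_simps)
  then have "(w' - w) \<bullet> (w' - w) = (a - u $ 1) * ((w' - w) \<bullet> pd 1 f x) + (b - u $ 2) * ((w' - w) \<bullet> pd 2 f x)"
    by (metis inner_add_right inner_scaleR_right)
  also have "\<dots> = 0"
    using w w' by (simp add: inner_diff_left normal_space_at_iff[OF f])
  finally show "w' = w" by simp
qed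

definition gram :: "(real^2 \<Rightarrow> real^'n) \<Rightarrow> real^2 \<Rightarrow> real" where
  "gram f x = (pd 1 f x \<bullet> pd 1 f x) * (pd 2 f x \<bullet> pd 2 f x) - (pd 1 f x \<bullet> pd 2 f x)\<^sup>2"

lemma gram_nonzero:
  fixes f :: "real^2 \<Rightarrow> real^'n"
  assumes f: "f differentiable (at x)" and i: "inj (frechet_derivative f (at x))"
  shows "gram f x \<noteq> 0"
proof
  assume g: "gram f x = 0"
  have l: "linear (frechet_derivative f (at x))"
    using f linear_frechet_derivative by blast
  have z: "v = 0" if "frechet_derivative f (at x) v = 0" for v
    using i that linear_injective_0[OF l] by blast
  let ?v = "vector [pd 2 f x \<bullet> pd 2 f x, - (pd 1 f x \<bullet> pd 2 f x)] :: real^2"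
  let ?w = "frechet_derivative f (at x) ?v"
  have "?w \<bullet> ?w = (pd 2 f x \<bullet> pd 2 f x) * gram f x"
    unfolding frechet_derivative_pd[OF f] gram_def
    by (simp add: inner_simps inner_commute[of "pd 2 f x" "pd 1 f x"] power2_eq_square algebra_simps)
  then have "?v = 0" using g by (intro z) simp
  then have "?v $ 1 = 0" by simp
  then have "pd 2 f x = 0" by simp
  then have "axis 2 1 = (0 :: real^2)"
    by (intro z) (simp add: pd_def)
  then show False by simp
qed

locale immersed_surface =
  fixes f :: "real^2 \<Rightarrow> real^'n"
  assumes Ck: "Ck_on 2 UNIV f"
    and immersion: "inj (frechet_derivative f (at x))"
begin

abbreviation "P \<equiv> normal_proj f"
abbreviation "g11 x \<equiv> pd 1 f x \<bullet> pd 1 f x"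
abbreviation "g12 x \<equiv> pd 1 f x \<bullet> pd 2 f x"
abbreviation "g22 x \<equiv> pd 2 f x \<bullet> pd 2 f x"

lemma diff: "f differentiable (at x)"
  using Ck by (simp add: numeral_2_eq_2)

lemma diff_pd: "pd i f differentiable (at x)"
  using Ck by (simp add: numeral_2_eq_2 pd_def[abs_def])

lemma gram [simp]: "gram f x \<noteq> 0"
  by (rule gram_nonzero[OF diff immersion])

definition "tc1 v x = (g22 x * (v \<bullet> pd 1 f x) - g12 x * (v \<bullet> pd 2 f x)) / gram f x"
definition "tc2 v x = (g11 x * (v \<bullet> pd 2 f x) - g12 x * (v \<bullet> pd 1 f x)) / gram f x"

lemma P_eq: "P x v = v - tc1 v x *\<^sub>R pd 1 f x - tc2 v x *\<^sub>R pd 2 f x"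
proof (rule normal_proj_eqI[OF diff])
  show "v = (v - tc1 v x *\<^sub>R pd 1 f x - tc2 v x *\<^sub>R pd 2 f x) + tc1 v x *\<^sub>R pd 1 f x + tc2 v x *\<^sub>R pd 2 f x"
    by simp
  have "gram f x * ((v - tc1 v x *\<^sub>R pd 1 f x - tc2 v x *\<^sub>R pd 2 f x) \<bullet> pd 1 f x) = 0"
    by (simp add: inner_simps tc1_def tc2_def right_diff_distrib)
       (simp add: gram_def inner_commute[of "pd 2 f x" "pd 1 f x"] algebra_simps power2_eq_square)
  then show "(v - tc1 v x *\<^sub>R pd 1 f x - tc2 v x *\<^sub>R pd 2 f x) \<bullet> pd 1 f x = 0" by simp
  have "gram f x * ((v - tc1 v x *\<^sub>R pd 1 f x - tc2 v x *\<^sub>R pd 2 f x) \<bullet> pd 2 f x) = 0"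
    by (simp add: inner_simps tc1_def tc2_def right_diff_distrib)
       (simp add: gram_def inner_commute[of "pd 2 f x" "pd 1 f x"] algebra_simps power2_eq_square)
  then show "(v - tc1 v x *\<^sub>R pd 1 f x - tc2 v x *\<^sub>R pd 2 f x) \<bullet> pd 2 f x = 0" by simp
qed

lemma linear_P: "linear (P x)"
  by (rule linearI)
    (simp_all add: P_eq tc1_def tc2_def inner_simps algebra_simps add_divide_distrib diff_divide_distrib)

lemma P_add: "P x (v + w) = P x v + P x w"
  and P_diff: "P x (v - w) = P x v - P x w"
  and P_scale: "P x (c *\<^sub>R v) = c *\<^sub>R P x v"
  using linear_P by (simp_all add: linear_add linear_diff linear_cmul)

lemma P_normal: "w \<bullet> pd 1 f x = 0 \<Longrightarrow> w \<bullet> pd 2 f x = 0 \<Longrightarrow> P x w = w"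
  by (rule normal_proj_eqI[OF diff, where a = 0 and b = 0]) auto

lemma P_pd: "P x (pd 1 f x) = 0" "P x (pd 2 f x) = 0"
  by (rule normal_proj_eqI[OF diff, where a = 1 and b = 0]; simp)
     (rule normal_proj_eqI[OF diff, where a = 0 and b = 1]; simp)

lemma inner_P: "P x v \<bullet> pd 1 f x = 0" "P x v \<bullet> pd 2 f x = 0"
proof -
  have "gram f x * (P x v \<bullet> pd 1 f x) = 0" "gram f x * (P x v \<bullet> pd 2 f x) = 0"
    by (simp_all add: P_eq inner_simps tc1_def tc2_def right_diff_distrib)
       (simp_all add: gram_def inner_commute[of "pd 2 f x" "pd 1 f x"] algebra_simps power2_eq_square)
  then show "P x v \<bullet> pd 1 f x = 0" "P x v \<bullet> pd 2 f x = 0" by simp_all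
qed

lemma P_P: "P x (P x v) = P x v"
  by (simp add: P_normal inner_P)

context
  fixes \<nu> :: "real^2 \<Rightarrow> real^'n"
  assumes Ck_\<nu>: "Ck_on 2 UNIV \<nu>"
    and normal: "\<nu> x \<in> normal_space_at f x"
begin

lemma diff_\<nu>: "\<nu> differentiable (at x)"
  using Ck_\<nu> by (simp add: numeral_2_eq_2)

lemma diff_pd_\<nu>: "pd i \<nu> differentiable (at x)"
  using Ck_\<nu> by (simp add: numeral_2_eq_2 pd_def[abs_def])

lemma inner_pd_\<nu>:
  assumes "j = 1 \<or> j = 2"
  shows "pd i \<nu> x \<bullet> pd j f x = - (\<nu> x \<bullet> pd i (pd j f) x)"
proof -
  have "((\<lambda>y. \<nu> y \<bullet> pd j f y) has_derivative (\<lambda>v. \<nu> x \<bullet> frechet_derivative (pd j f) (at x) v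
      + frechet_derivative \<nu> (at x) v \<bullet> pd j f x)) (at x)"
    using diff_pd diff_\<nu> by (intro has_derivative_inner) (simp_all add: frechet_derivative_works)
  moreover have "\<nu> y \<bullet> pd j f y = 0" for y
    using assms normal normal_space_at_iff[OF diff] by blast
  ultimately have "((\<lambda>y. 0) has_derivative (\<lambda>v. \<nu> x \<bullet> frechet_derivative (pd j f) (at x) v
      + frechet_derivative \<nu> (at x) v \<bullet> pd j f x)) (at x)" by simp
  from has_derivative_unique[OF this has_derivative_const]
  show ?thesis by (auto simp: pd_def dest!: fun_cong[of _ _ "axis i 1"])
qed

definition "N i x = P x (pd i \<nu> x)"

lemma N_eq: "N i = (\<lambda>x. pd i \<nu> x - tc1 (pd i \<nu> x) x *\<^sub>R pd 1 f x - tc2 (pd i \<nu> x) x *\<^sub>R pd 2 f x)"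
  by (simp add: N_def[abs_def] P_eq)

lemma normal_conn_eq: "normal_conn f Y \<nu> = (\<lambda>x. Y x $ 1 *\<^sub>R N 1 x + Y x $ 2 *\<^sub>R N 2 x)"
  by (simp add: normal_conn_def[abs_def] deriv_along_def frechet_derivative_pd[OF diff_\<nu>] P_add P_scale N_def)

lemma diff_tc:
  "(\<lambda>x. tc1 (pd i \<nu> x) x) differentiable (at x)" "(\<lambda>x. tc2 (pd i \<nu> x) x) differentiable (at x)"
proof -
  have "(\<lambda>x. gram f x) differentiable (at x)"
    unfolding gram_def by (intro derivative_intros differentiable_inner diff_pd)
  then show "(\<lambda>x. tc1 (pd i \<nu> x) x) differentiable (at x)" "(\<lambda>x. tc2 (pd i \<nu> x) x) differentiable (at x)"
    unfolding tc1_def tc2_def by (intro derivative_intros differentiable_inner diff_pd diff_pd_\<nu>; simp)+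
qed

lemma diff_N: "N i differentiable (at x)"
  unfolding N_eq by (intro derivative_intros diff_pd diff_pd_\<nu> diff_tc)

lemma P_pd_N: "P x (pd j (N i) x) = P x (pd j (pd i \<nu>) x)
  - tc1 (pd i \<nu> x) x *\<^sub>R P x (pd j (pd 1 f) x) - tc2 (pd i \<nu> x) x *\<^sub>R P x (pd j (pd 2 f) x)"
proof -
  note d = frechet_derivative_works[THEN iffD1]
  have "pd j (N i) x = pd j (pd i \<nu>) x
    - (tc1 (pd i \<nu> x) x *\<^sub>R pd j (pd 1 f) x + pd j (\<lambda>x. tc1 (pd i \<nu> x) x) x *\<^sub>R pd 1 f x)
    - (tc2 (pd i \<nu> x) x *\<^sub>R pd j (pd 2 f) x + pd j (\<lambda>x. tc2 (pd i \<nu> x) x) x *\<^sub>R pd 2 f x)"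
    unfolding N_eq pd_def[of j]
    by (subst frechet_derivative_at[symmetric])
      (auto intro!: has_derivative_diff has_derivative_scaleR d diff_pd diff_pd_\<nu> diff_tc)
  then show ?thesis
    by (simp add: P_diff P_add P_scale P_pd)
qed

lemma normal_conn_normal_conn_eq:
  assumes Y: "Y differentiable (at x)"
  shows "normal_conn f X (normal_conn f Y \<nu>) x =
      deriv_along X Y x $ 1 *\<^sub>R N 1 x + deriv_along X Y x $ 2 *\<^sub>R N 2 x
    + Y x $ 1 *\<^sub>R (X x $ 1 *\<^sub>R P x (pd 1 (N 1) x) + X x $ 2 *\<^sub>R P x (pd 2 (N 1) x))
    + Y x $ 2 *\<^sub>R (X x $ 1 *\<^sub>R P x (pd 1 (N 2) x) + X x $ 2 *\<^sub>R P x (pd 2 (N 2) x))"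
proof -
  note d = frechet_derivative_works[THEN iffD1]
  have Yi: "((\<lambda>x. Y x $ i) has_derivative (\<lambda>v. frechet_derivative Y (at x) v $ i)) (at x)" for i
    by (rule bounded_linear.has_derivative[OF bounded_linear_vec_nth d[OF Y]])
  have "deriv_along X (normal_conn f Y \<nu>) x =
     (Y x $ 1 *\<^sub>R frechet_derivative (N 1) (at x) (X x) + deriv_along X Y x $ 1 *\<^sub>R N 1 x)
   + (Y x $ 2 *\<^sub>R frechet_derivative (N 2) (at x) (X x) + deriv_along X Y x $ 2 *\<^sub>R N 2 x)"
    unfolding normal_conn_eq deriv_along_def
    by (subst frechet_derivative_at[symmetric])
      (auto intro!: has_derivative_add has_derivative_scaleR d[OF diff_N] Yi)
  moreover have "P x (N i x) = N i x" for i
    by (simp add: N_def P_P)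
  ultimately show ?thesis
    by (simp add: normal_conn_def[of f X] P_add P_scale frechet_derivative_pd[OF diff_N] algebra_simps)
qed

definition ricci :: "real^2 \<Rightarrow> real^'n" where
  "ricci x =
     g22 x *\<^sub>R ((\<nu> x \<bullet> pd 1 (pd 2 f) x) *\<^sub>R pd 1 (pd 1 f) x - (\<nu> x \<bullet> pd 1 (pd 1 f) x) *\<^sub>R pd 1 (pd 2 f) x)
   - g12 x *\<^sub>R ((\<nu> x \<bullet> pd 2 (pd 2 f) x) *\<^sub>R pd 1 (pd 1 f) x - (\<nu> x \<bullet> pd 1 (pd 1 f) x) *\<^sub>R pd 2 (pd 2 f) x)
   + g11 x *\<^sub>R ((\<nu> x \<bullet> pd 2 (pd 2 f) x) *\<^sub>R pd 1 (pd 2 f) x - (\<nu> x \<bullet> pd 1 (pd 2 f) x) *\<^sub>R pd 2 (pd 2 f) x)"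

lemma normal_curvature_eq:
  assumes X: "X differentiable (at x)" and Y: "Y differentiable (at x)"
  shows "gram f x *\<^sub>R normal_curvature f X Y \<nu> x
    = (X x $ 1 * Y x $ 2 - X x $ 2 * Y x $ 1) *\<^sub>R P x (ricci x)"
proof -
  have c: "pd 2 (pd 1 f) x = pd 1 (pd 2 f) x" "pd 2 (pd 1 \<nu>) x = pd 1 (pd 2 \<nu>) x"
    using Ck Ck_\<nu> by (simp_all add: pd_pd_commute)
  have t: "gram f x * tc1 (pd i \<nu> x) x = g12 x * (\<nu> x \<bullet> pd i (pd 2 f) x) - g22 x * (\<nu> x \<bullet> pd i (pd 1 f) x)"
     "gram f x * tc2 (pd i \<nu> x) x = g12 x * (\<nu> x \<bullet> pd i (pd 1 f) x) - g11 x * (\<nu> x \<bullet> pd i (pd 2 f) x)" for i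
    by (simp_all add: tc1_def tc2_def inner_pd_\<nu>)
  have "normal_curvature f X Y \<nu> x
    = (X x $ 1 * Y x $ 2 - X x $ 2 * Y x $ 1) *\<^sub>R (P x (pd 1 (N 2) x) - P x (pd 2 (N 1) x))"
    unfolding normal_curvature_def normal_conn_normal_conn_eq[OF X] normal_conn_normal_conn_eq[OF Y]
    by (simp add: normal_conn_eq lie_bracket_def algebra_simps)
  moreover have "gram f x *\<^sub>R (P x (pd 1 (N 2) x) - P x (pd 2 (N 1) x)) = P x (ricci x)"
    unfolding P_pd_N ricci_def c
    by (simp add: scaleR_diff_right scaleR_add_right t P_diff P_add P_scale c)
       (simp add: algebra_simps)
  ultimately show ?thesis
    by (simp only: scaleR_left_commute[of "gram f x"])
qed

end

end

section \<open>First variation of derivatives and the flatness polynomial\<close>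

lemma pd_cong:
  assumes "open A" "x \<in> A" "f differentiable (at x)" "\<And>y. y \<in> A \<Longrightarrow> f y = g y"
  shows "pd i f x = pd i g x"
  unfolding pd_def using frechet_derivative_transform_within_open[OF assms(3,1,2,4)] by simp

definition dx :: "'m::finite \<Rightarrow> ((real^'m) \<times> real \<Rightarrow> 'b::euclidean_space) \<Rightarrow> (real^'m) \<times> real \<Rightarrow> 'b" where
  "dx i g z = frechet_derivative g (at z) (axis i 1, 0)"

definition dt :: "((real^'m) \<times> real \<Rightarrow> 'b::euclidean_space) \<Rightarrow> (real^'m) \<times> real \<Rightarrow> 'b" where
  "dt g z = frechet_derivative g (at z) (0, 1)"

lemma
  assumes "g differentiable (at (x, t))"
  shows slice_differentiable: "(\<lambda>y. g (y, t)) differentiable (at x)"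
    and slice_pd: "pd i (\<lambda>y. g (y, t)) x = dx i g (x, t)"
    and slice_dt: "((\<lambda>s. g (x, s)) has_vector_derivative dt g (x, t)) (at t)"
proof -
  have g: "(g has_derivative frechet_derivative g (at (x, t))) (at (x, t))"
    using assms by (simp add: frechet_derivative_works)
  have "((\<lambda>y. (y, t)) has_derivative (\<lambda>v. (v, 0))) (at x)"
    by (auto intro!: derivative_eq_intros)
  from has_derivative_compose[OF this g]
  have *: "((\<lambda>y. g (y, t)) has_derivative (\<lambda>v. frechet_derivative g (at (x, t)) (v, 0))) (at x)" .
  then show "(\<lambda>y. g (y, t)) differentiable (at x)"
    by (rule differentiableI)
  show "pd i (\<lambda>y. g (y, t)) x = dx i g (x, t)"
    using pd_eqI[OF *] by (simp add: dx_def)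
  have "((\<lambda>s. (x, s)) has_derivative (\<lambda>r. (0, r))) (at t)"
    by (auto intro!: derivative_eq_intros)
  from has_derivative_compose[OF this g]
  have "((\<lambda>s. g (x, s)) has_derivative (\<lambda>r. frechet_derivative g (at (x, t)) (0, r))) (at t)" .
  moreover have "frechet_derivative g (at (x, t)) (0, r) = r *\<^sub>R dt g (x, t)" for r
    using linear_cmul[OF has_derivative_linear[OF g], of r "(0, 1)"] by (simp add: dt_def)
  ultimately show "((\<lambda>s. g (x, s)) has_vector_derivative dt g (x, t)) (at t)"
    by (simp add: has_vector_derivative_def)
qed

lemma Ck_on_dx: "Ck_on (Suc k) U g \<Longrightarrow> Ck_on k U (dx i g)"
  by (simp add: dx_def[abs_def])

lemma Ck_on_dt: "Ck_on (Suc k) U g \<Longrightarrow> Ck_on k U (dt g)"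
  by (simp add: dt_def[abs_def])

lemma dt_dx_commute:
  assumes "open U" "z \<in> U" "Ck_on 2 U g"
  shows "dt (dx i g) z = dx i (dt g) z"
  using frechet_derivative_commute[OF assms] by (simp add: dt_def[abs_def] dx_def[abs_def])

text \<open>The smooth extension of \<open>f\<close> past time \<open>0\<close> makes the symmetry of second derivatives available at
  the boundary point \<open>t = 0\<close>.\<close>

lemma has_vector_derivative_pd_evolution:
  fixes f :: "real \<Rightarrow> real^'m \<Rightarrow> 'b::euclidean_space"
  assumes T: "0 < T"
    and smooth: "smooth_on (UNIV \<times> {0..<T}) (\<lambda>(x, t). f t x)"
    and h: "\<And>x. ((\<lambda>t. f t x) has_vector_derivative h x) (at 0 within {0..<T})"
  shows "((\<lambda>t. pd i (f t) x) has_vector_derivative pd i h x) (at 0 within {0..<T})"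
    and "((\<lambda>t. pd i (pd j (f t)) x) has_vector_derivative pd i (pd j h) x) (at 0 within {0..<T})"
proof -
  have "(x, 0) \<in> UNIV \<times> {0..<T}" using T by simp
  then obtain U g where U: "open U" "(x, 0) \<in> U" and g: "\<And>k. Ck_on k U g"
    and gf: "\<forall>y\<in>(UNIV \<times> {0..<T}) \<inter> U. g y = (\<lambda>(x, t). f t x) y"
    using smooth unfolding smooth_on_def by metis
  obtain A I where A: "open A" "x \<in> A" and I: "open I" "0 \<in> I" and AI: "A \<times> I \<subseteq> U"
    using open_prod_elim[OF U] by (metis mem_Sigma_iff)
  have gf: "g (y, t) = f t y" if "y \<in> A" "t \<in> I" "t \<in> {0..<T}" for y t
    using gf that AI by auto
  have d: "\<phi> differentiable (at (y, t))" if "y \<in> A" "t \<in> I" "Ck_on (Suc 0) U \<phi>" for y t \<phi>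
    using that AI by auto
  have C: "Ck_on k U (dx i g)" "Ck_on k U (dt g)" "Ck_on k U (dx i (dx j g))" "Ck_on k U (dt (dx j g))"
     "Ck_on k U (dx j (dt g))" for k i j
    by (intro Ck_on_dx Ck_on_dt g)+
  have p1: "pd i (f t) y = dx i g (y, t)" if "y \<in> A" "t \<in> I" "t \<in> {0..<T}" for y t i
  proof -
    have "pd i (\<lambda>y. g (y, t)) y = pd i (f t) y"
      using that gf by (intro pd_cong[OF A(1)] slice_differentiable d g) auto
    then show ?thesis using slice_pd[OF d[OF that(1,2) g]] by metis
  qed
  have p2: "pd i (pd j (f t)) y = dx i (dx j g) (y, t)" if "y \<in> A" "t \<in> I" "t \<in> {0..<T}" for y t i j
  proof -
    have "pd i (\<lambda>y. dx j g (y, t)) y = pd i (pd j (f t)) y"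
      using that p1 by (intro pd_cong[OF A(1)] slice_differentiable d C) auto
    then show ?thesis using slice_pd[OF d[OF that(1,2) C(1)]] by metis
  qed
  have lim: "((\<lambda>t. F t) has_vector_derivative dt \<phi> (y, 0)) (at 0 within {0..<T})"
    if "y \<in> A" and \<phi>: "Ck_on (Suc 0) U \<phi>" and F: "\<And>t. t \<in> I \<Longrightarrow> t \<in> {0..<T} \<Longrightarrow> F t = \<phi> (y, t)"
    for F y and \<phi> :: "(real^'m) \<times> real \<Rightarrow> 'b"
  proof -
    obtain e where e: "e > 0" "ball 0 e \<subseteq> I"
      using I openE by blast
    have "((\<lambda>t. \<phi> (y, t)) has_vector_derivative dt \<phi> (y, 0)) (at 0 within {0..<T})"
      by (rule has_vector_derivative_at_within[OF slice_dt[OF d[OF that(1) I(2) \<phi>]]])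
    moreover have "\<phi> (y, t) = F t" if "t \<in> {0..<T}" "dist t 0 < e" for t
    proof -
      have "t \<in> ball 0 e" using that by (simp add: dist_commute)
      then have "t \<in> I" using e(2) by blast
      then show ?thesis using F[OF _ that(1)] by simp
    qed
    moreover have "0 \<in> {0..<T}" using T by simp
    ultimately show ?thesis
      using has_vector_derivative_transform_within[OF _ e(1)] by blast
  qed
  have h': "dt g (y, 0) = h y" if "y \<in> A" for y
  proof -
    have "((\<lambda>t. f t y) has_vector_derivative dt g (y, 0)) (at 0 within {0..<T})"
      using that g gf by (intro lim) auto
    moreover have "at 0 within {0..<T} \<noteq> bot"
      using T by (simp add: trivial_limit_within islimpt_Ico)
    ultimately show ?thesis
      using h[of y] vector_derivative_unique_within by blast
  qed
  have h1: "dt (dx i g) (y, 0) = pd i h y" if "y \<in> A" for y i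
  proof -
    have "dt (dx i g) (y, 0) = dx i (dt g) (y, 0)"
      using that AI I by (intro dt_dx_commute[OF U(1) _ g]) auto
    also have "\<dots> = pd i (\<lambda>y. dt g (y, 0)) y"
      by (rule slice_pd[symmetric, OF d[OF that I(2) C(2)]])
    also have "\<dots> = pd i h y"
      using that h' I by (intro pd_cong[OF A(1)] slice_differentiable d C) auto
    finally show ?thesis .
  qed
  have h2: "dt (dx i (dx j g)) (x, 0) = pd i (pd j h) x"
  proof -
    have "dt (dx i (dx j g)) (x, 0) = dx i (dt (dx j g)) (x, 0)"
      using A AI I by (intro dt_dx_commute[OF U(1) _ C(1)]) auto
    also have "\<dots> = pd i (\<lambda>y. dt (dx j g) (y, 0)) x"
      by (rule slice_pd[symmetric, OF d[OF A(2) I(2) C(4)]])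
    also have "\<dots> = pd i (pd j h) x"
      using A h1 I by (intro pd_cong[OF A(1)] slice_differentiable d C) auto
    finally show ?thesis .
  qed
  show "((\<lambda>t. pd i (f t) x) has_vector_derivative pd i h x) (at 0 within {0..<T})"
    unfolding h1[OF A(2), symmetric] by (intro lim A C p1)
  show "((\<lambda>t. pd i (pd j (f t)) x) has_vector_derivative pd i (pd j h) x) (at 0 within {0..<T})"
    unfolding h2[symmetric] by (intro lim A C p2)
qed

definition vec4 :: "real \<Rightarrow> real \<Rightarrow> real \<Rightarrow> real \<Rightarrow> real^4" where
  "vec4 a b c d = a *\<^sub>R axis 1 1 + b *\<^sub>R axis 2 1 + c *\<^sub>R axis 3 1 + d *\<^sub>R axis 4 1"

lemma vec4_nth [simp]:
  "vec4 a b c d $ 1 = a" "vec4 a b c d $ 2 = b" "vec4 a b c d $ 3 = c" "vec4 a b c d $ 4 = d"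
  by (simp_all add: vec4_def axis_def)

lemma inner_4: "(x :: real^4) \<bullet> y = x $ 1 * y $ 1 + x $ 2 * y $ 2 + x $ 3 * y $ 3 + x $ 4 * y $ 4"
  by (simp add: inner_vec_def sum_4)

lemma vec4_eq_iff: "(x :: real^4) = y \<longleftrightarrow> x $ 1 = y $ 1 \<and> x $ 2 = y $ 2 \<and> x $ 3 = y $ 3 \<and> x $ 4 = y $ 4"
  by (simp add: vec_eq_iff forall_4)

text \<open>Up to sign, \<open>normal1 u v\<close> and \<open>normal2 u v\<close> are the four-dimensional cross products of \<open>u\<close>,
  \<open>v\<close> and the first, respectively the last, basis vector. Applied to the coordinate derivatives of an
  immersion they give normal fields that are polynomial in these derivatives and invariant under deck
  transformations.\<close>

definition normal1 :: "real^4 \<Rightarrow> real^4 \<Rightarrow> real^4" where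
  "normal1 u v = vec4 0 (u $ 3 * v $ 4 - u $ 4 * v $ 3) (u $ 4 * v $ 2 - u $ 2 * v $ 4) (u $ 2 * v $ 3 - u $ 3 * v $ 2)"

definition normal2 :: "real^4 \<Rightarrow> real^4 \<Rightarrow> real^4" where
  "normal2 u v = vec4 (u $ 2 * v $ 3 - u $ 3 * v $ 2) (u $ 3 * v $ 1 - u $ 1 * v $ 3) (u $ 1 * v $ 2 - u $ 2 * v $ 1) 0"

lemma inner_normal1: "normal1 u v \<bullet> u = 0" "normal1 u v \<bullet> v = 0"
  by (simp_all add: normal1_def inner_4 algebra_simps)

lemma inner_normal2: "normal2 u v \<bullet> u = 0" "normal2 u v \<bullet> v = 0"
  by (simp_all add: normal2_def inner_4 algebra_simps)

lemma bounded_bilinear_normal1: "bounded_bilinear normal1"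
  unfolding bilinear_conv_bounded_bilinear[symmetric] bilinear_def
  by (auto intro!: linearI simp: vec4_eq_iff normal1_def algebra_simps)

lemma bounded_bilinear_normal2: "bounded_bilinear normal2"
  unfolding bilinear_conv_bounded_bilinear[symmetric] bilinear_def
  by (auto intro!: linearI simp: vec4_eq_iff normal2_def algebra_simps)

text \<open>Up to a nonzero factor this is the \<open>normal1\<close>-\<open>normal2\<close> component of the normal curvature, where
  \<open>u\<close>, \<open>v\<close> are the first and \<open>p\<close>, \<open>q\<close>, \<open>r\<close> the second derivatives (11, 12, 22).\<close>

definition commutator :: "real^4 \<Rightarrow> real^4 \<Rightarrow> real^4 \<Rightarrow> real^4 \<Rightarrow> real^4 \<Rightarrow> real" where
  "commutator u v p q r =
     (v \<bullet> v) * ((normal1 u v \<bullet> q) * (normal2 u v \<bullet> p) - (normal1 u v \<bullet> p) * (normal2 u v \<bullet> q))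
   - (u \<bullet> v) * ((normal1 u v \<bullet> r) * (normal2 u v \<bullet> p) - (normal1 u v \<bullet> p) * (normal2 u v \<bullet> r))
   + (u \<bullet> u) * ((normal1 u v \<bullet> r) * (normal2 u v \<bullet> q) - (normal1 u v \<bullet> q) * (normal2 u v \<bullet> r))"

lemma torus_cover_eq_imp_periodic:
  assumes "torus_cover x = torus_cover y"
  shows "torus_cover (z + (y - x)) = torus_cover z"
proof -
  have "cis (2 * pi * (z $ i + (y $ i - x $ i))) = cis (2 * pi * z $ i) * cis (2 * pi * y $ i) / cis (2 * pi * x $ i)" for i
    by (simp add: cis_mult cis_divide algebra_simps)
  then show ?thesis
    using assms by (simp add: torus_cover_def)
qed

lemma frechet_derivative_torus_cover_eq:
  assumes "torus_cover x = torus_cover y" and G: "\<And>x. (G \<circ> torus_cover) differentiable (at x)"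
  shows "frechet_derivative (G \<circ> torus_cover) (at x) = frechet_derivative (G \<circ> torus_cover) (at y)"
proof -
  have "((\<lambda>z. z + (y - x)) has_derivative (\<lambda>v. v)) (at x)"
    by (auto intro!: derivative_eq_intros)
  moreover have "((G \<circ> torus_cover) has_derivative frechet_derivative (G \<circ> torus_cover) (at y)) (at (x + (y - x)))"
    using G by (simp add: frechet_derivative_works)
  ultimately have "((\<lambda>z. (G \<circ> torus_cover) (z + (y - x))) has_derivative frechet_derivative (G \<circ> torus_cover) (at y)) (at x)"
    by (rule has_derivative_compose)
  moreover have "(\<lambda>z. (G \<circ> torus_cover) (z + (y - x))) = G \<circ> torus_cover"
    using torus_cover_eq_imp_periodic[OF assms(1)] by auto
  ultimately show ?thesis
    using frechet_derivative_at by metis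
qed

lemma torus_immersion_immersed_surface:
  assumes "torus_immersion G"
  shows "immersed_surface (G \<circ> torus_cover)"
  using assms by unfold_locales (auto simp: torus_immersion_def torus_smooth_def smooth_on_UNIV)

lemma flat_normal_bundle_imp_commutator:
  fixes G :: "complex \<times> complex \<Rightarrow> real^4"
  assumes imm: "torus_immersion G" and flat: "flat_normal_bundle G"
  defines "f \<equiv> G \<circ> torus_cover"
  shows "commutator (pd 1 f x) (pd 2 f x) (pd 1 (pd 1 f) x) (pd 1 (pd 2 f) x) (pd 2 (pd 2 f) x) = 0"
proof -
  interpret immersed_surface f
    unfolding f_def by (rule torus_immersion_immersed_surface[OF imm])
  have sm: "Ck_on k UNIV f" for k
    using imm by (auto simp: torus_immersion_def torus_smooth_def smooth_on_UNIV f_def)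
  define \<nu> where "\<nu> x = normal1 (pd 1 f x) (pd 2 f x)" for x
  have Ck_\<nu>: "Ck_on k UNIV \<nu>" for k
    unfolding \<nu>_def by (intro Ck_on_bilinear[OF bounded_bilinear_normal1] Ck_on_pd sm open_UNIV)
  have n\<nu>: "\<nu> x \<in> normal_space_at f x" for x
    by (simp add: normal_space_at_iff[OF diff] \<nu>_def inner_normal1)
  have per: "\<nu> x = \<nu> y" if "torus_cover x = torus_cover y" for x y
    unfolding \<nu>_def pd_def f_def
    using frechet_derivative_torus_cover_eq[OF that, of G] diff by (simp add: f_def)
  define \<nu>' where "\<nu>' p = \<nu> (SOME x. torus_cover x = p)" for p
  have \<nu>': "\<nu>' (torus_cover x) = \<nu> x" for x
    unfolding \<nu>'_def by (rule per) (metis (mono_tags, lifting) someI)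
  then have \<nu>'c: "\<nu>' \<circ> torus_cover = \<nu>" by auto
  have "torus_normal_field G \<nu>'"
    using n\<nu> by (auto simp: torus_normal_field_def torus_smooth_def smooth_on_UNIV \<nu>'c Ck_\<nu> \<nu>' f_def)
  moreover define X where "X i = (\<lambda>p::complex \<times> complex. axis i 1 :: real^2)" for i
  have Xc: "X i \<circ> torus_cover = (\<lambda>x. axis i 1)" for i
    by (auto simp: X_def)
  have "torus_smooth (X i)" for i
    by (simp add: torus_smooth_def Xc smooth_on_UNIV Ck_on_const)
  ultimately have "normal_curvature f (X 1 \<circ> torus_cover) (X 2 \<circ> torus_cover) (\<nu>' \<circ> torus_cover) x = 0"
    using flat unfolding flat_normal_bundle_def f_def by blast
  then have "normal_curvature f (\<lambda>x. axis 1 1) (\<lambda>x. axis 2 1) \<nu> x = 0"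
    by (simp only: Xc \<nu>'c)
  moreover have "gram f x *\<^sub>R normal_curvature f (\<lambda>x. axis 1 1) (\<lambda>x. axis 2 1) \<nu> x = P x (ricci \<nu> x)"
    by (subst normal_curvature_eq[OF Ck_\<nu> n\<nu>]) (simp_all add: axis_def)
  ultimately have "P x (ricci \<nu> x) = 0" by simp
  moreover have "normal2 (pd 1 f x) (pd 2 f x) \<bullet> P x w = normal2 (pd 1 f x) (pd 2 f x) \<bullet> w" for w
    by (simp add: P_eq inner_simps inner_normal2)
  ultimately have "normal2 (pd 1 f x) (pd 2 f x) \<bullet> ricci \<nu> x = 0"
    by (metis inner_zero_right)
  then show ?thesis
    unfolding ricci_def[OF Ck_\<nu> n\<nu>] commutator_def \<nu>_def
    by (simp add: inner_simps algebra_simps)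
qed

section \<open>A torus with flat normal bundle\<close>

lemma has_derivative_vec4:
  assumes "(a has_derivative a') F" "(b has_derivative b') F" "(c has_derivative c') F" "(d has_derivative d') F"
  shows "((\<lambda>x. vec4 (a x) (b x) (c x) (d x)) has_derivative (\<lambda>v. vec4 (a' v) (b' v) (c' v) (d' v))) F"
  unfolding vec4_def by (intro has_derivative_add has_derivative_scaleR_left assms)

lemma vec4_arith [simp]:
  "vec4 a b c d + vec4 a' b' c' d' = vec4 (a + a') (b + b') (c + c') (d + d')"
  "vec4 a b c d - vec4 a' b' c' d' = vec4 (a - a') (b - b') (c - c') (d - d')"
  "k *\<^sub>R vec4 a b c d = vec4 (k * a) (k * b) (k * c) (k * d)"
  "vec4 a b c d \<bullet> vec4 a' b' c' d' = a * a' + b * b' + c * c' + d * d'"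
  "vec4 a b c d = vec4 a' b' c' d' \<longleftrightarrow> a = a' \<and> b = b' \<and> c = c' \<and> d = d'"
  by (simp_all add: vec4_eq_iff inner_4)

lemma Ck_on_vec4:
  assumes "open U" "Ck_on k U a" "Ck_on k U b" "Ck_on k U c" "Ck_on k U d"
  shows "Ck_on k U (\<lambda>x. vec4 (a x) (b x) (c x) (d x))"
  unfolding vec4_def by (intro Ck_on_add Ck_on_bounded_linear[OF bounded_linear_scaleR_left] assms)

lemmas has_derivative_nth = bounded_linear_imp_has_derivative[OF bounded_linear_vec_nth]

text \<open>The plane curve with support function \<open>h(s) = 10 + 2 sin 2s\<close> is \<open>e\<^sup>i\<^sup>s (h + i h') = 10 u + i (u\<^sup>3 + 3 cnj u)\<close>
  with \<open>u = e\<^sup>i\<^sup>s\<close>. Its parallel curve at distance \<open>3 sin \<theta>\<close> has support function \<open>h + 3 sin \<theta>\<close> and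
  speed \<open>h + h'' + 3 sin \<theta>\<close>, called \<open>stretch\<close> below.\<close>

definition warped_plane :: "complex \<times> complex \<Rightarrow> complex" where
  "warped_plane p = of_real (10 + 3 * Im (snd p)) * fst p + \<i> * (fst p ^ 3 + 3 * cnj (fst p))"

definition warped_torus :: "complex \<times> complex \<Rightarrow> real^4" where
  "warped_torus p = vec4 (Re (warped_plane p)) (Im (warped_plane p)) (4 * Im (snd p)) (5 * Re (snd p))"

text \<open>Kept opaque so that the simplifier does not evaluate multiples of \<open>\<pi>\<close> inside \<open>sin\<close> and \<open>cos\<close>.\<close>

definition freq :: real where "freq = 2 * pi"

abbreviation angle1 :: "real^2 \<Rightarrow> real" where "angle1 x \<equiv> freq * x $ 1"
abbreviation angle2 :: "real^2 \<Rightarrow> real" where "angle2 x \<equiv> freq * x $ 2"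

definition stretch :: "real^2 \<Rightarrow> real" where
  "stretch x = 10 - 6 * sin (2 * angle1 x) + 3 * sin (angle2 x)"

definition warped :: "real^2 \<Rightarrow> real^4" where
  "warped x = vec4
    ((10 + 3 * sin (angle2 x)) * cos (angle1 x) + 3 * sin (angle1 x) - sin (3 * angle1 x))
    ((10 + 3 * sin (angle2 x)) * sin (angle1 x) + 3 * cos (angle1 x) + cos (3 * angle1 x))
    (4 * sin (angle2 x)) (5 * cos (angle2 x))"

definition "warped1 x = freq *\<^sub>R vec4 (- stretch x * sin (angle1 x)) (stretch x * cos (angle1 x)) 0 0"
definition "warped2 x = freq *\<^sub>R vec4 (3 * cos (angle2 x) * cos (angle1 x)) (3 * cos (angle2 x) * sin (angle1 x))
   (4 * cos (angle2 x)) (- 5 * sin (angle2 x))"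
definition "warped11 x = freq\<^sup>2 *\<^sub>R vec4
   (12 * cos (2 * angle1 x) * sin (angle1 x) - stretch x * cos (angle1 x))
   (- 12 * cos (2 * angle1 x) * cos (angle1 x) - stretch x * sin (angle1 x)) 0 0"
definition "warped12 x = freq\<^sup>2 *\<^sub>R vec4 (- 3 * cos (angle2 x) * sin (angle1 x)) (3 * cos (angle2 x) * cos (angle1 x)) 0 0"
definition "warped22 x = freq\<^sup>2 *\<^sub>R vec4 (- 3 * sin (angle2 x) * cos (angle1 x)) (- 3 * sin (angle2 x) * sin (angle1 x))
   (- 4 * sin (angle2 x)) (- 5 * cos (angle2 x))"

lemma freq_pos [simp]: "freq > 0" "freq \<noteq> 0"
  by (simp_all add: freq_def)

lemma stretch_pos: "stretch x > 0"
proof -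
  have "sin (2 * angle1 x) \<le> 1" "- 1 \<le> sin (angle2 x)" by simp_all
  then show ?thesis unfolding stretch_def by linarith
qed

lemma warped_torus_torus_cover: "warped_torus \<circ> torus_cover = warped"
proof
  fix x
  have "cis (angle1 x) ^ 3 = cis (3 * angle1 x)"
    using Complex.DeMoivre[of "angle1 x" 3] by simp
  then show "(warped_torus \<circ> torus_cover) x = warped x"
    by (simp add: warped_torus_def warped_plane_def warped_def torus_cover_def freq_def[symmetric])
qed

lemma sin_3: "sin (3 * s) = 2 * sin (2 * s) * cos s - sin (s::real)"
  and cos_3: "cos (3 * s) = cos s - 2 * sin (2 * s) * sin (s::real)"
proof -
  have "3 * s = 2 * s + s" by simp
  then have "sin (3 * s) = sin (2 * s) * cos s + cos (2 * s) * sin s"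
    "cos (3 * s) = cos (2 * s) * cos s - sin (2 * s) * sin s"
    by (metis sin_add cos_add)+
  moreover have "sin s = sin (2 * s) * cos s - cos (2 * s) * sin s"
    "cos s = cos (2 * s) * cos s + sin (2 * s) * sin s"
    using sin_diff[of "2 * s" s] cos_diff[of "2 * s" s] by simp_all
  ultimately show "sin (3 * s) = 2 * sin (2 * s) * cos s - sin s"
     "cos (3 * s) = cos s - 2 * sin (2 * s) * sin s" by linarith+
qed

lemma has_derivative_stretch:
  "(stretch has_derivative (\<lambda>v. - 12 * freq * cos (2 * angle1 x) * v $ 1 + 3 * freq * cos (angle2 x) * v $ 2)) (at x)"
  unfolding stretch_def
  by (rule has_derivative_eq_rhs, (rule derivative_eq_intros has_derivative_nth refl)+)
    (simp add: fun_eq_iff algebra_simps)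

lemma has_derivative_warped: "(warped has_derivative (\<lambda>v. v $ 1 *\<^sub>R warped1 x + v $ 2 *\<^sub>R warped2 x)) (at x)"
  unfolding warped_def
  apply (rule has_derivative_eq_rhs, rule has_derivative_vec4)
  apply (rule derivative_eq_intros has_derivative_nth refl)+
  by (simp add: fun_eq_iff warped1_def warped2_def stretch_def sin_3 cos_3) (simp add: algebra_simps)

lemma has_derivative_warped1: "(warped1 has_derivative (\<lambda>v. v $ 1 *\<^sub>R warped11 x + v $ 2 *\<^sub>R warped12 x)) (at x)"
  unfolding warped1_def
  by (rule has_derivative_eq_rhs, rule has_derivative_scaleR_right, rule has_derivative_vec4)
    ((rule derivative_eq_intros has_derivative_nth has_derivative_stretch refl)+,
     simp add: fun_eq_iff warped11_def warped12_def power2_eq_square algebra_simps)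

lemma has_derivative_warped2: "(warped2 has_derivative (\<lambda>v. v $ 1 *\<^sub>R warped12 x + v $ 2 *\<^sub>R warped22 x)) (at x)"
  unfolding warped2_def
  by (rule has_derivative_eq_rhs, rule has_derivative_scaleR_right, rule has_derivative_vec4)
    ((rule derivative_eq_intros has_derivative_nth refl)+,
     simp add: fun_eq_iff warped22_def warped12_def power2_eq_square algebra_simps)

lemma pd_warped: "pd 1 warped = warped1" "pd 2 warped = warped2"
  using pd_eqI[OF has_derivative_warped] by (auto simp: fun_eq_iff axis_def)

lemma pd_warped1: "pd 1 warped1 = warped11" "pd 2 warped1 = warped12"
  using pd_eqI[OF has_derivative_warped1] by (auto simp: fun_eq_iff axis_def)

lemma pd_warped2: "pd 1 warped2 = warped12" "pd 2 warped2 = warped22"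
  using pd_eqI[OF has_derivative_warped2] by (auto simp: fun_eq_iff axis_def)

lemmas pds = pd_warped pd_warped1 pd_warped2

lemma sin_sq: "sin (a::real) * sin a = 1 - cos a * cos a" "sin a * (sin a * b) = (1 - cos a * cos a) * b"
proof -
  show *: "sin a * sin a = 1 - cos a * cos a"
    using sin_squared_eq[of a] by (simp add: power2_eq_square)
  show "sin a * (sin a * b) = (1 - cos a * cos a) * b"
    by (simp only: * mult.assoc[symmetric])
qed

lemma metric_warped:
  "warped1 x \<bullet> warped1 x = freq\<^sup>2 * (stretch x)\<^sup>2" "warped1 x \<bullet> warped2 x = 0" "warped2 x \<bullet> warped2 x = 25 * freq\<^sup>2"
  unfolding warped1_def warped2_def by (simp_all add: power2_eq_square sin_sq algebra_simps)

lemma Ck_on_warped: "Ck_on k UNIV warped"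
proof -
  have "bounded_linear (\<lambda>x::real^2. c * x $ i)" for c i
    by (intro bounded_linear_const_mult bounded_linear_vec_nth)
  from Ck_on_sin_cos[OF this]
  have t: "Ck_on k UNIV (\<lambda>x::real^2. sin (c * x $ i))" "Ck_on k UNIV (\<lambda>x::real^2. cos (c * x $ i))" for c i
    by auto
  have m: "Ck_on k UNIV (\<lambda>x. a x * b x)" if "Ck_on k UNIV a" "Ck_on k UNIV b"
    for a b :: "real^2 \<Rightarrow> real"
    by (rule Ck_on_bilinear[OF bounded_bilinear_mult open_UNIV that])
  have d: "a - b = a + (- 1) * b" for a b :: real by simp
  show ?thesis
    unfolding warped_def d mult.assoc[of _ freq, symmetric]
    by (intro Ck_on_vec4 Ck_on_add m t Ck_on_const open_UNIV)
qed

lemma immersion_warped: "inj (frechet_derivative warped (at x))"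
proof -
  have f: "frechet_derivative warped (at x) = (\<lambda>v. v $ 1 *\<^sub>R warped1 x + v $ 2 *\<^sub>R warped2 x)"
    by (rule frechet_derivative_at[symmetric, OF has_derivative_warped])
  have "v = 0" if "v $ 1 *\<^sub>R warped1 x + v $ 2 *\<^sub>R warped2 x = 0" for v :: "real^2"
  proof -
    have "(v $ 1 *\<^sub>R warped1 x + v $ 2 *\<^sub>R warped2 x) \<bullet> warped1 x = 0" "(v $ 1 *\<^sub>R warped1 x + v $ 2 *\<^sub>R warped2 x) \<bullet> warped2 x = 0"
      by (simp_all add: that)
    then have "v $ 1 = 0" "v $ 2 = 0"
      using stretch_pos[of x] by (simp_all add: inner_simps metric_warped inner_commute[of "warped2 x" "warped1 x"])
    then show ?thesis by (simp add: vec_eq_iff forall_2)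
  qed
  moreover have "linear (frechet_derivative warped (at x))"
    using has_derivative_warped linear_frechet_derivative differentiableI by blast
  ultimately show ?thesis
    unfolding linear_injective_0[OF \<open>linear _\<close>] unfolding f by blast
qed

lemma torus_immersion_warped_torus: "torus_immersion warped_torus"
  by (simp add: torus_immersion_def torus_smooth_def smooth_on_UNIV warped_torus_torus_cover Ck_on_warped immersion_warped)

lemma inj_on_warped_torus: "inj_on warped_torus torus"
proof (rule inj_onI)
  fix p q
  assume p: "p \<in> torus" and q: "q \<in> torus" and eq: "warped_torus p = warped_torus q"
  obtain u w where pu: "p = (u, w)" by (cases p)
  obtain u' w' where qu: "q = (u', w')" by (cases q)
  have n: "norm u = 1" "norm u' = 1" "norm w = 1"
    using p q by (auto simp: torus_def pu qu dist_norm)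
  have w: "w' = w"
    using eq by (auto simp: warped_torus_def pu qu complex_eq_iff)
  define c where "c = 10 + 3 * Im w"
  have "c \<ge> 7"
    using abs_Im_le_cmod[of w] n by (simp add: c_def)
  have "warped_plane p = warped_plane q"
    using eq by (simp add: warped_torus_def complex_eq_iff)
  then have "of_real c * (u - u') = - \<i> * ((u - u') * (u\<^sup>2 + u * u' + u'\<^sup>2) + 3 * cnj (u - u'))"
    by (simp add: warped_plane_def pu qu w c_def algebra_simps power2_eq_square power3_eq_cube)
  then have "norm (of_real c * (u - u')) = norm (- \<i> * ((u - u') * (u\<^sup>2 + u * u' + u'\<^sup>2) + 3 * cnj (u - u')))"
    by metis
  then have "c * norm (u - u') = norm ((u - u') * (u\<^sup>2 + u * u' + u'\<^sup>2) + 3 * cnj (u - u'))"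
    using \<open>c \<ge> 7\<close> by (simp add: norm_mult)
  also have "\<dots> \<le> norm (u - u') * norm (u\<^sup>2 + u * u' + u'\<^sup>2) + 3 * norm (u - u')"
    by (rule order_trans[OF norm_triangle_ineq]) (simp add: norm_mult del: complex_cnj_diff)
  also have "norm (u\<^sup>2 + u * u' + u'\<^sup>2) \<le> 3"
    using n norm_triangle_ineq[of "u\<^sup>2 + u * u'" "u'\<^sup>2"] norm_triangle_ineq[of "u\<^sup>2" "u * u'"]
    by (simp add: norm_mult norm_power)
  finally have "c * norm (u - u') \<le> 6 * norm (u - u')"
    by (simp add: mult_left_mono)
  then have "(c - 6) * norm (u - u') \<le> 0" by (simp add: algebra_simps)
  then have "norm (u - u') = 0"
    using \<open>c \<ge> 7\<close> by (simp add: mult_le_0_iff)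
  then show "p = q" by (simp add: pu qu w)
qed

lemma torus_embedding_warped_torus: "torus_embedding warped_torus"
proof -
  have "compact torus"
    unfolding torus_def by (intro compact_Times compact_sphere)
  moreover have "continuous_on torus warped_torus"
    unfolding warped_torus_def warped_plane_def vec4_def by (intro continuous_intros)
  ultimately have "embedding_map (top_of_set torus) euclidean warped_torus"
    using inj_on_warped_torus
    by (intro injective_closed_imp_embedding_map T1_Spaces.continuous_imp_closed_map)
      (auto simp: compact_space_subtopology Hausdorff_space_euclidean)
  then show ?thesis
    by (simp add: torus_embedding_def torus_immersion_warped_torus)
qed

interpretation warped_surface: immersed_surface warped
  by unfold_locales (simp_all add: Ck_on_warped immersion_warped)

lemma warped12_eq: "warped12 x = (3 * freq * cos (angle2 x) / stretch x) *\<^sub>R warped1 x"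
  using stretch_pos[of x] by (simp add: warped12_def warped1_def power2_eq_square)

lemma flat_normal_bundle_warped_torus: "flat_normal_bundle warped_torus"
  unfolding flat_normal_bundle_def
proof (intro allI impI)
  fix X Y :: "complex \<times> complex \<Rightarrow> real^2" and \<nu> x
  assume X: "torus_smooth X" and Y: "torus_smooth Y" and \<nu>: "torus_normal_field warped_torus \<nu>"
  define n where "n = \<nu> \<circ> torus_cover"
  have n: "Ck_on 2 UNIV n" "n x \<in> normal_space_at warped x" for x
    using \<nu> by (auto simp: torus_normal_field_def torus_smooth_def smooth_on_UNIV warped_torus_torus_cover n_def)
  have "(X \<circ> torus_cover) differentiable (at x)" "(Y \<circ> torus_cover) differentiable (at x)"
    using X Y Ck_on.simps(2)[of 0 UNIV] by (auto simp: torus_smooth_def smooth_on_UNIV simp del: Ck_on.simps)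
  note warped_surface.normal_curvature_eq[OF n this]
  moreover have "n x \<bullet> warped12 x = 0"
    using n(2) unfolding normal_space_at_iff[OF warped_surface.diff] pds warped12_eq by simp
  then have "warped_surface.ricci n x = (25 * freq\<^sup>2 * - (n x \<bullet> warped11 x) + freq\<^sup>2 * (stretch x)\<^sup>2 * (n x \<bullet> warped22 x)) *\<^sub>R warped12 x"
    unfolding warped_surface.ricci_def[OF n] pds metric_warped by (simp add: algebra_simps)
  then have "warped_surface.P x (warped_surface.ricci n x) = 0"
    using warped_surface.P_pd by (simp add: warped12_eq warped_surface.P_scale pds)
  ultimately show "normal_curvature (warped_torus \<circ> torus_cover) (X \<circ> torus_cover) (Y \<circ> torus_cover) (\<nu> \<circ> torus_cover) x = 0"
    using warped_surface.gram[of x] by (simp add: n_def[symmetric] warped_torus_torus_cover del: warped_surface.gram)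
qed

lemma matrix_inv_eqI:
  fixes A :: "'a::semiring_1^'n^'m"
  assumes "A ** B = mat 1" "B ** A = mat 1"
  shows "matrix_inv A = B"
  unfolding matrix_inv_def
proof (rule some_equality)
  fix C assume "A ** C = mat 1 \<and> C ** A = mat 1"
  then show "C = B"
    using assms by (metis matrix_mul_assoc matrix_mul_lid matrix_mul_rid)
qed (use assms in simp)

lemma mean_curvature_orthogonal:
  fixes f :: "real^2 \<Rightarrow> real^'n"
  assumes "pd 1 f x \<bullet> pd 2 f x = 0" "pd 1 f x \<noteq> 0" "pd 2 f x \<noteq> 0"
  shows "mean_curvature f x =
     (1 / (pd 1 f x \<bullet> pd 1 f x)) *\<^sub>R normal_proj f x (pd 1 (pd 1 f) x)
   + (1 / (pd 2 f x \<bullet> pd 2 f x)) *\<^sub>R normal_proj f x (pd 2 (pd 2 f) x)"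
proof -
  define D where "D = (\<chi> i j. if i = j then 1 / (pd i f x \<bullet> pd i f x) else 0 :: real^2^2)"
  have "matrix_inv (induced_metric f x) = D"
    using assms
    by (intro matrix_inv_eqI)
      (simp_all add: matrix_matrix_mult_def mat_def vec_eq_iff forall_2 sum_2 D_def induced_metric_def
        inner_commute[of "pd 2 f x" "pd 1 f x"])
  then show ?thesis
    by (simp add: mean_curvature_def sum_2 D_def second_ff_def)
qed

definition warped_mc :: "real^2 \<Rightarrow> real^4" where
  "warped_mc x = vec4
    ((- (1 - 9 / 25 * (cos (angle2 x))\<^sup>2) / stretch x - 3 / 25 * sin (angle2 x)) * cos (angle1 x))
    ((- (1 - 9 / 25 * (cos (angle2 x))\<^sup>2) / stretch x - 3 / 25 * sin (angle2 x)) * sin (angle1 x))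
    (12 / 25 * (cos (angle2 x))\<^sup>2 / stretch x - 4 / 25 * sin (angle2 x))
    (- (3 / 5) * cos (angle2 x) * sin (angle2 x) / stretch x - 1 / 5 * cos (angle2 x))"

lemma normal_proj_warped11: "normal_proj warped x (warped11 x) = (freq\<^sup>2 * stretch x) *\<^sub>R vec4
    (- (1 - 9 / 25 * (cos (angle2 x))\<^sup>2) * cos (angle1 x)) (- (1 - 9 / 25 * (cos (angle2 x))\<^sup>2) * sin (angle1 x))
    (12 / 25 * (cos (angle2 x))\<^sup>2) (- (3 / 5) * cos (angle2 x) * sin (angle2 x))"
  using stretch_pos[of x]
  by (intro normal_proj_eqI[OF warped_surface.diff, where a = "- 12 * freq * cos (2 * angle1 x) / stretch x"
        and b = "- 3 / 25 * freq * stretch x * cos (angle2 x)"])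
    (simp_all add: pds warped1_def warped2_def warped11_def power2_eq_square sin_sq field_simps)

lemma normal_proj_warped22: "normal_proj warped x (warped22 x) = warped22 x"
  by (intro normal_proj_eqI[OF warped_surface.diff, where a = 0 and b = 0])
    (simp_all add: pds warped1_def warped2_def warped22_def sin_sq power2_eq_square algebra_simps)

lemma mean_curvature_warped: "mean_curvature warped = warped_mc"
proof
  fix x
  have "warped1 x \<bullet> warped1 x \<noteq> 0" "warped2 x \<bullet> warped2 x \<noteq> 0"
    using stretch_pos[of x] by (simp_all add: metric_warped)
  then have "pd 1 warped x \<noteq> 0" "pd 2 warped x \<noteq> 0"
    by (auto simp: pds)
  then have "mean_curvature warped x = (1 / (freq\<^sup>2 * (stretch x)\<^sup>2)) *\<^sub>R normal_proj warped x (warped11 x)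
      + (1 / (25 * freq\<^sup>2)) *\<^sub>R warped22 x"
    by (simp add: mean_curvature_orthogonal pds metric_warped normal_proj_warped22)
  then show "mean_curvature warped x = warped_mc x"
    using stretch_pos[of x] unfolding normal_proj_warped11
    by (simp add: warped_mc_def warped22_def field_simps power2_eq_square)
qed

definition "warped_mc2 x = freq *\<^sub>R vec4
  ((3 * cos (angle2 x) * (1 - 9 / 25 * (cos (angle2 x))\<^sup>2) / (stretch x)\<^sup>2 - 18 / 25 * cos (angle2 x) * sin (angle2 x) / stretch x
     - 3 / 25 * cos (angle2 x)) * cos (angle1 x))
  ((3 * cos (angle2 x) * (1 - 9 / 25 * (cos (angle2 x))\<^sup>2) / (stretch x)\<^sup>2 - 18 / 25 * cos (angle2 x) * sin (angle2 x) / stretch x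
     - 3 / 25 * cos (angle2 x)) * sin (angle1 x))
  (- 24 / 25 * cos (angle2 x) * sin (angle2 x) / stretch x - 36 / 25 * cos (angle2 x) ^ 3 / (stretch x)\<^sup>2 - 4 / 25 * cos (angle2 x))
  (- (3 / 5) * ((cos (angle2 x))\<^sup>2 - (sin (angle2 x))\<^sup>2) / stretch x + 9 / 5 * (cos (angle2 x))\<^sup>2 * sin (angle2 x) / (stretch x)\<^sup>2
     + 1 / 5 * sin (angle2 x))"

lemma stretch_nz [simp]: "stretch x \<noteq> 0"
  using stretch_pos[of x] by simp

lemma stretch_0 [simp]: "stretch 0 = 10"
  by (simp add: stretch_def)

lemma has_derivative_inverse_stretch:
  "((\<lambda>x. inverse (stretch x)) has_derivative
    (\<lambda>v. (12 * freq * cos (2 * angle1 x) * v $ 1 - 3 * freq * cos (angle2 x) * v $ 2) / (stretch x)\<^sup>2)) (at x)"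
  by (rule has_derivative_eq_rhs, rule Deriv.has_derivative_inverse[OF stretch_nz has_derivative_stretch])
    (simp add: fun_eq_iff power2_eq_square field_simps)

lemma pd_warped_mc: "pd 2 warped_mc = warped_mc2" "pd 1 warped_mc 0 = freq *\<^sub>R vec4 (- 48 / 625) (- 8 / 125) (36 / 625) 0"
proof -
  have d: "a / stretch x = a * inverse (stretch x)" for a x by (simp add: divide_inverse)
  have "\<exists>D. (warped_mc has_derivative D) (at x) \<and> D (axis 2 1) = warped_mc2 x \<and>
     (x = 0 \<longrightarrow> D (axis 1 1) = freq *\<^sub>R vec4 (- 48 / 625) (- 8 / 125) (36 / 625) 0)" for x
    unfolding warped_mc_def d
    apply (rule exI conjI)+
     apply (rule has_derivative_vec4)
     apply (rule has_derivative_inverse_stretch has_derivative_nth derivative_eq_intros refl)+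
    apply (rule conjI)
    subgoal
      by (simp add: axis_def warped_mc2_def field_simps power2_eq_square power3_eq_cube)
    by (simp add: axis_def field_simps)
  then have *: "pd 2 warped_mc x = warped_mc2 x \<and> (x = 0 \<longrightarrow> pd 1 warped_mc x = freq *\<^sub>R vec4 (- 48 / 625) (- 8 / 125) (36 / 625) 0)" for x
    by (metis pd_eqI)
  show "pd 2 warped_mc = warped_mc2" using * by auto
  show "pd 1 warped_mc 0 = freq *\<^sub>R vec4 (- 48 / 625) (- 8 / 125) (36 / 625) 0" using * by auto
qed

lemma pd_warped_mc2: "pd 1 warped_mc2 0 = freq\<^sup>2 *\<^sub>R vec4 (144 / 3125) (- 63 / 625) (- 108 / 3125) (- 9 / 125)"
proof -
  have d: "a / stretch x = a * inverse (stretch x)" "a / (stretch x)\<^sup>2 = a * (inverse (stretch x))\<^sup>2" for a x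
    by (simp_all add: power2_eq_square divide_inverse)
  have "\<exists>D. (warped_mc2 has_derivative D) (at 0) \<and>
     D (axis 1 1) = freq\<^sup>2 *\<^sub>R vec4 (144 / 3125) (- 63 / 625) (- 108 / 3125) (- 9 / 125)"
    unfolding warped_mc2_def d
    apply (rule exI conjI)+
     apply (rule has_derivative_scaleR_right has_derivative_vec4)+
     apply (rule has_derivative_inverse_stretch has_derivative_nth derivative_eq_intros refl)+
    by (simp add: axis_def field_simps power2_eq_square)
  then show ?thesis
    by (metis pd_eqI)
qed

section \<open>The initial derivative of the commutator\<close>

lemma has_real_derivative_inner:
  assumes "(f has_vector_derivative f') (at t within S)" "(g has_vector_derivative g') (at t within S)"
  shows "((\<lambda>t. f t \<bullet> g t) has_real_derivative f t \<bullet> g' + f' \<bullet> g t) (at t within S)"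
  unfolding has_real_derivative_iff_has_vector_derivative
  by (rule bounded_bilinear.has_vector_derivative[OF bounded_bilinear_inner assms])

text \<open>The derivatives of \<open>p\<close> and \<open>r\<close> do not enter, because initially \<open>q\<close> is tangent and \<open>u\<close>, \<open>v\<close> are
  orthogonal.\<close>

lemma has_real_derivative_commutator:
  assumes u: "(u has_vector_derivative pd 1 warped_mc 0) (at 0 within S)" and u0: "u 0 = warped1 0"
    and v: "(v has_vector_derivative warped_mc2 0) (at 0 within S)" and v0: "v 0 = warped2 0"
    and p: "(p has_vector_derivative p') (at 0 within S)" and p0: "p 0 = warped11 0"
    and q: "(q has_vector_derivative pd 1 warped_mc2 0) (at 0 within S)" and q0: "q 0 = warped12 0"
    and r: "(r has_vector_derivative r') (at 0 within S)" and r0: "r 0 = warped22 0"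
  shows "((\<lambda>t. commutator (u t) (v t) (p t) (q t) (r t)) has_real_derivative - 57600 * freq ^ 10) (at 0 within S)"
proof -
  note n1 = bounded_bilinear.has_vector_derivative[OF bounded_bilinear_normal1 u v]
  note n2 = bounded_bilinear.has_vector_derivative[OF bounded_bilinear_normal2 u v]
  note i = has_real_derivative_inner
  have vals: "warped1 0 = freq *\<^sub>R vec4 0 10 0 0" "warped2 0 = freq *\<^sub>R vec4 3 0 4 0"
    "warped11 0 = freq\<^sup>2 *\<^sub>R vec4 (- 10) (- 12) 0 0" "warped12 0 = freq\<^sup>2 *\<^sub>R vec4 0 3 0 0"
    "warped22 0 = freq\<^sup>2 *\<^sub>R vec4 0 0 0 (- 5)" "warped_mc2 0 = freq *\<^sub>R vec4 (- 63 / 625) 0 (- 109 / 625) (- 3 / 50)"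
    by (simp_all add: warped1_def warped2_def warped11_def warped12_def warped22_def warped_mc2_def)
  show ?thesis
    unfolding commutator_def
    by (rule DERIV_cong, (rule DERIV_add DERIV_diff DERIV_mult i u v n1 n2 p q r)+)
      (simp add: u0 v0 p0 q0 r0 vals pd_warped_mc pd_warped_mc2 normal1_def normal2_def inner_4 power2_eq_square,
       simp add: eval_nat_numeral algebra_simps)
qed

lemma eventually_nonzero_right:
  fixes f :: "real \<Rightarrow> real"
  assumes "(f has_real_derivative D) (at 0 within {0..<T})" "D \<noteq> 0" "f 0 = 0" "0 < T"
  shows "\<exists>\<delta>\<in>{0<..<T}. \<forall>t\<in>{0<..<\<delta>}. f t \<noteq> 0"
proof -
  have "((\<lambda>t. f t / t) \<longlongrightarrow> D) (at 0 within {0..<T})"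
    using assms(1,3) by (simp add: has_field_derivative_iff)
  then have "\<forall>\<^sub>F t in at 0 within {0..<T}. f t / t \<noteq> 0"
    using assms(2) tendsto_imp_eventually_ne by blast
  then obtain d where d: "d > 0" "\<And>t. t \<in> {0..<T} \<Longrightarrow> t \<noteq> 0 \<Longrightarrow> dist t 0 < d \<Longrightarrow> f t / t \<noteq> 0"
    unfolding eventually_at by blast
  show ?thesis
  proof (intro bexI ballI)
    show "min d (T / 2) \<in> {0<..<T}" using d(1) assms(4) by auto
    show "f t \<noteq> 0" if "t \<in> {0<..<min d (T / 2)}" for t
      using d(2)[of t] that assms(4) by auto
  qed
qed

theorem theorem1p1:
  shows "\<exists>F0 :: complex \<times> complex \<Rightarrow> real^4.
    torus_embedding F0 \<and> flat_normal_bundle F0 \<and>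
    (\<forall>T F. torus_mcf F0 T F \<longrightarrow>
       (\<exists>\<delta>\<in>{0<..<T}. \<forall>t\<in>{0<..<\<delta>}. \<not> flat_normal_bundle (F t)))"
proof (rule exI[of _ warped_torus], intro conjI allI impI)
  fix T :: real and F :: "real \<Rightarrow> complex \<times> complex \<Rightarrow> real^4"
  assume mcf: "torus_mcf warped_torus T F"
  define f where "f t = F t \<circ> torus_cover" for t
  have T: "0 < T" using mcf by (simp add: torus_mcf_def)
  have initial: "f 0 = warped"
    using mcf by (auto simp: torus_mcf_def f_def warped_torus_torus_cover[symmetric] torus_def torus_cover_def)
  have "smooth_on (UNIV \<times> {0..<T}) (\<lambda>(x, t). f t x)"
    using mcf by (simp add: torus_mcf_def f_def)
  moreover have "((\<lambda>t. f t x) has_vector_derivative warped_mc x) (at 0 within {0..<T})" for x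
  proof -
    have "((\<lambda>t. f t x) has_vector_derivative mean_curvature (f 0) x) (at 0 within {0..<T})"
      using mcf T by (auto simp: torus_mcf_def f_def)
    then show ?thesis by (simp add: initial mean_curvature_warped)
  qed
  ultimately have d: "((\<lambda>t. pd i (f t) 0) has_vector_derivative pd i warped_mc 0) (at 0 within {0..<T})"
    "((\<lambda>t. pd i (pd j (f t)) 0) has_vector_derivative pd i (pd j warped_mc) 0) (at 0 within {0..<T})" for i j
    using has_vector_derivative_pd_evolution[OF T] by blast+
  define B where "B t = commutator (pd 1 (f t) 0) (pd 2 (f t) 0) (pd 1 (pd 1 (f t)) 0)
    (pd 1 (pd 2 (f t)) 0) (pd 2 (pd 2 (f t)) 0)" for t
  have flat: "B t = 0" if "torus_immersion (F t)" "flat_normal_bundle (F t)" for t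
    using flat_normal_bundle_imp_commutator[OF that] by (simp add: B_def f_def)
  have "B 0 = 0"
    using flat_normal_bundle_imp_commutator[OF torus_immersion_warped_torus flat_normal_bundle_warped_torus, of 0]
    by (simp add: B_def initial warped_torus_torus_cover)
  moreover have "(B has_real_derivative - 57600 * freq ^ 10) (at 0 within {0..<T})"
    unfolding B_def
    by (rule has_real_derivative_commutator[OF d(1) _ d(1)[of 2, unfolded pd_warped_mc] _ d(2) _ d(2)[of 1 2, unfolded pd_warped_mc] _ d(2)])
      (simp_all add: initial pds)
  ultimately obtain \<delta> where "\<delta> \<in> {0<..<T}" "\<forall>t\<in>{0<..<\<delta>}. B t \<noteq> 0"
    using eventually_nonzero_right T freq_pos(2) by (metis mult_eq_0_iff neg_equal_0_iff_equal power_eq_0_iff zero_neq_numeral)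
  moreover have "torus_immersion (F t)" if "t \<in> {0..<T}" for t
    using mcf that by (simp add: torus_mcf_def)
  ultimately show "\<exists>\<delta>\<in>{0<..<T}. \<forall>t\<in>{0<..<\<delta>}. \<not> flat_normal_bundle (F t)"
    using flat by (intro bexI[of _ \<delta>]) auto
qed (rule torus_embedding_warped_torus flat_normal_bundle_warped_torus)+

end
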